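(* Fix $\sigma\in\mathcal U$. Let $\{u_n;n\in\mathbb N^+\}$ be a sequence of regular $\sigma$-potentials converging increasingly to some $u$. Assume further that $t\mapsto u(t,x+X^\sigma_t)$ is $\mathbb P\otimes dx$-a.e. continuous with $$\int_{\mathbb R^d}E\sup_{t\in[0,T]}|u(t,x+X^\sigma_t)|^2\,dx<\infty.$$ Then $u$ is a regular $\sigma$-potential.
   Context: Setting. $T\in(0,\infty)$ is fixed. $(\Omega,\mathscr F,\{\mathscr F_t\}_{t\ge0},\mathbb P)$ is a complete filtered probability space carrying an $m$-dimensional Wiener process $W$, $\{\mathscr F_t\}$ being its natural augmented filtration; $E_{\mathscr F_t}$ is conditional expectation. $U\subset\mathbb R^{d\times m}$ is nonempty and bounded; $\mathcal U$ is the set of $U$-valued $\{\mathscr F_t\}$-adapted processes; $X^\sigma_t:=\int_0^t\sigma_s\,dW_s$. $L^2=L^2(\mathbb R^d)$. For a Banach space $V$, $\mathcal S^2(V)$ is the set of $V$-valued adapted continuous processes with $E\sup_{t\in[0,T]}\|X_t\|_V^2<\infty$ and $\mathcal L^2(V)$ the set of $V$-valued adapted processes with $E\int_0^T\|X_t\|_V^2dt<\infty$. Versions with the best available properties are always chosen. $\sigma$-quasi-continuity. A random function $u:\Omega\times[0,T]\times\mathbb R^d\to\bar{\mathbb R}$ is $\sigma$-quasi-continuous if for each $\varepsilon>0$ there is a predictable random set $D^\varepsilon\subset\Omega\times[0,T]\times\mathbb R^d$ such that $\mathbb P$-a.s. the section $D^\varepsilon_\omega$ is open, $u(\omega,\cdot,\cdot)$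 is continuous on $(D^\varepsilon_\omega)^c$, and $\mathbb P\otimes dx\big((\omega,x):\exists t\in[0,T]\text{ s.t. }(\omega,t,x+X^\sigma_t(\omega))\in D^\varepsilon\big)\le\varepsilon$. Regular $\sigma$-potential. For $u\in\mathcal L^2(L^2)$ and $s\ge0$ put $P^\sigma_su(t,x)=E_{\mathscr F_t}[u(t+s,x+X^\sigma_{t+s}-X^\sigma_t)]$ if $t+s\le T$ and $P^\sigma_su(t,x)=0$ otherwise. $u\in\mathcal S^2(L^2)$ is a regular $\sigma$-potential if $u$ is $\sigma$-quasi-continuous, $\lim_{t\to T}u(t,\cdot)=0$ in $L^2$ a.s., $E\int_{\mathbb R^d}\sup_{t\in[0,T]}|u(t,x+X^\sigma_t)|^2dx<\infty$, and $P^\sigma_su(t)\le u(t)$ $\mathbb P\otimes dx$-a.e. for all $(t,s)\in[0,T]\times(0,\infty)$. *)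

theory Defs
  imports "HOL-Probability.Probability"
begin

section \<open>The Wiener process and its augmented natural filtration\<close>

text \<open>Vectors in \<open>real ^ 'm\<close> carry the noise, \<open>real ^ 'd\<close> is the state space, and
  \<open>real ^ 'm ^ 'd\<close> is the space of \<open>d \<times> m\<close> matrices (its norm is the Frobenius norm).\<close>

definition augmented_filtration ::
  "'w measure \<Rightarrow> (real \<Rightarrow> 'w \<Rightarrow> real ^ 'm) \<Rightarrow> real \<Rightarrow> 'w measure" where
  "augmented_filtration M W t =
     sigma (space M) ({W s -` B \<inter> space M | s B. 0 \<le> s \<and> s \<le> t \<and> B \<in> sets borel} \<union> null_sets M)"

definition wiener_process :: "'w measure \<Rightarrow> (real \<Rightarrow> 'w \<Rightarrow> real ^ 'm) \<Rightarrow> bool" where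
  "wiener_process M W \<longleftrightarrow>
     (\<forall>t\<ge>0. W t \<in> borel_measurable M) \<and>
     (AE \<omega> in M. W 0 \<omega> = 0) \<and>
     (AE \<omega> in M. continuous_on {0..} (\<lambda>t. W t \<omega>)) \<and>
     (\<forall>s t. 0 \<le> s \<and> s < t \<longrightarrow>
        (\<forall>i. distributed M lborel (\<lambda>\<omega>. (W t \<omega> - W s \<omega>) $ i) (normal_density 0 (sqrt (t - s)))) \<and>
        prob_space.indep_vars M (\<lambda>_. borel) (\<lambda>i \<omega>. (W t \<omega> - W s \<omega>) $ i) UNIV \<and>
        prob_space.indep_set M (sets (augmented_filtration M W s))
          {(\<lambda>\<omega>. W t \<omega> - W s \<omega>) -` B \<inter> space M | B. B \<in> sets borel})"

section \<open>Controls and their stochastic integrals\<close>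

text \<open>Adapted processes are jointly measurable in time and chance, so that time integrals of
  their paths make sense.\<close>

definition controls ::
  "'w measure \<Rightarrow> (real \<Rightarrow> 'w \<Rightarrow> real ^ 'm) \<Rightarrow> real \<Rightarrow> (real ^ 'm ^ 'd) set
     \<Rightarrow> (real \<Rightarrow> 'w \<Rightarrow> real ^ 'm ^ 'd) set" where
  "controls M W T U = {\<sigma>.
     (\<lambda>(t, \<omega>). \<sigma> t \<omega>) \<in> borel_measurable (restrict_space borel {0..T} \<Otimes>\<^sub>M M) \<and>
     (\<forall>t\<in>{0..T}. \<sigma> t \<in> borel_measurable (augmented_filtration M W t)) \<and>
     (\<forall>t\<in>{0..T}. \<forall>\<omega>\<in>space M. \<sigma> t \<omega> \<in> U)}"

text \<open>An elementary integrand takes the bounded \<open>\<F>\<^bsub>\<tau> i\<^esub>\<close>-measurable value \<open>\<xi> i\<close> on each interval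
  \<open>(\<tau> i, \<tau> (i+1)]\<close>, for \<open>i < k\<close>.\<close>

definition elementary_data ::
  "'w measure \<Rightarrow> (real \<Rightarrow> 'w \<Rightarrow> real ^ 'm) \<Rightarrow> real
     \<Rightarrow> nat \<Rightarrow> (nat \<Rightarrow> real) \<Rightarrow> (nat \<Rightarrow> 'w \<Rightarrow> real ^ 'm ^ 'd) \<Rightarrow> bool" where
  "elementary_data M W T k \<tau> \<xi> \<longleftrightarrow>
     0 \<le> \<tau> 0 \<and> (\<forall>i<k. \<tau> i < \<tau> (Suc i)) \<and> \<tau> k \<le> T \<and>
     (\<forall>i<k. \<xi> i \<in> borel_measurable (augmented_filtration M W (\<tau> i)) \<and> bounded (\<xi> i ` space M))"

definition elementary_process ::
  "nat \<Rightarrow> (nat \<Rightarrow> real) \<Rightarrow> (nat \<Rightarrow> 'w \<Rightarrow> real ^ 'm ^ 'd) \<Rightarrow> real \<Rightarrow> 'w \<Rightarrow> real ^ 'm ^ 'd" where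
  "elementary_process k \<tau> \<xi> t \<omega> =
     (\<Sum>i<k. if \<tau> i < t \<and> t \<le> \<tau> (Suc i) then \<xi> i \<omega> else 0)"

definition elementary_integral ::
  "(real \<Rightarrow> 'w \<Rightarrow> real ^ 'm) \<Rightarrow> nat \<Rightarrow> (nat \<Rightarrow> real) \<Rightarrow> (nat \<Rightarrow> 'w \<Rightarrow> real ^ 'm ^ 'd)
     \<Rightarrow> real \<Rightarrow> 'w \<Rightarrow> real ^ 'd" where
  "elementary_integral W k \<tau> \<xi> t \<omega> =
     (\<Sum>i<k. \<xi> i \<omega> *v (W (min t (\<tau> (Suc i))) \<omega> - W (min t (\<tau> i)) \<omega>))"

text \<open>\<open>X\<close> is a continuous version of the Ito integral process \<open>\<integral>\<^sub>0\<^sup>t \<sigma>\<^sub>s dW\<^sub>s\<close>, \<open>0 \<le> t \<le> T\<close>: the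
  limit in mean square of the integrals of elementary processes approximating \<open>\<sigma>\<close> in
  \<open>L\<^sup>2(\<Omega> \<times> [0,T])\<close>. It is determined by \<open>\<sigma>\<close> up to indistinguishability.\<close>

definition is_ito_integral ::
  "'w measure \<Rightarrow> (real \<Rightarrow> 'w \<Rightarrow> real ^ 'm) \<Rightarrow> real \<Rightarrow> (real \<Rightarrow> 'w \<Rightarrow> real ^ 'm ^ 'd)
     \<Rightarrow> (real \<Rightarrow> 'w \<Rightarrow> real ^ 'd) \<Rightarrow> bool" where
  "is_ito_integral M W T \<sigma> X \<longleftrightarrow>
     (\<forall>t\<in>{0..T}. X t \<in> borel_measurable (augmented_filtration M W t)) \<and>
     (AE \<omega> in M. continuous_on {0..T} (\<lambda>t. X t \<omega>)) \<and>
     (\<exists>k \<tau> \<xi>. (\<forall>n. elementary_data M W T (k n) (\<tau> n) (\<xi> n)) \<and>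
        (\<lambda>n. \<integral>\<^sup>+\<omega>. (\<integral>\<^sup>+t\<in>{0..T}.
            ennreal ((norm (\<sigma> t \<omega> - elementary_process (k n) (\<tau> n) (\<xi> n) t \<omega>))\<^sup>2)
            \<partial>lborel) \<partial>M) \<longlonglongrightarrow> 0 \<and>
        (\<forall>t\<in>{0..T}. (\<lambda>n. \<integral>\<^sup>+\<omega>.
            ennreal ((norm (X t \<omega> - elementary_integral W (k n) (\<tau> n) (\<xi> n) t \<omega>))\<^sup>2)
            \<partial>M) \<longlonglongrightarrow> 0))"

section \<open>Random functions\<close>

text \<open>A random function \<open>\<Omega> \<times> [0,T] \<times> \<real>\<^sup>d \<rightarrow> [-\<infinity>,\<infinity>]\<close> is represented by
  \<open>u :: 'w \<Rightarrow> real \<Rightarrow> real ^ 'd \<Rightarrow> ereal\<close>; its values at times outside \<open>[0,T]\<close> are irrelevant.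
  Points of \<open>\<Omega> \<times> [0,T] \<times> \<real>\<^sup>d\<close> are written \<open>((\<omega>, t), x)\<close> below.\<close>

definition predictable_sigma ::
  "'w measure \<Rightarrow> (real \<Rightarrow> 'w \<Rightarrow> real ^ 'm) \<Rightarrow> real \<Rightarrow> ('w \<times> real) measure" where
  "predictable_sigma M W T = sigma (space M \<times> {0..T})
     ({A \<times> {0} | A. A \<in> sets (augmented_filtration M W 0)} \<union>
      {A \<times> {s<..t} | A s t. 0 \<le> s \<and> s < t \<and> t \<le> T \<and> A \<in> sets (augmented_filtration M W s)})"

text \<open>Up to indistinguishability, \<open>u\<close> is measurable with respect to the product of the predictable
  sigma-algebra and the Borel sets of \<open>\<real>\<^sup>d\<close>. Every adapted continuous \<open>L\<^sup>2\<close>-valued process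
  has such a version, and this is the version that is chosen.\<close>

definition predictable_version ::
  "'w measure \<Rightarrow> (real \<Rightarrow> 'w \<Rightarrow> real ^ 'm) \<Rightarrow> real \<Rightarrow> ('w \<Rightarrow> real \<Rightarrow> real ^ 'd \<Rightarrow> ereal) \<Rightarrow> bool"
  where
  "predictable_version M W T u \<longleftrightarrow>
     (\<exists>v. (\<lambda>((\<omega>, t), x). v \<omega> t x) \<in> borel_measurable (predictable_sigma M W T \<Otimes>\<^sub>M borel) \<and>
          (AE \<omega> in M. \<forall>t\<in>{0..T}. \<forall>x. u \<omega> t x = v \<omega> t x))"

definition abs_square :: "ereal \<Rightarrow> ennreal" where
  "abs_square y = (e2ennreal \<bar>y\<bar>)\<^sup>2"

definition l2_norm_square :: "(real ^ 'd \<Rightarrow> ereal) \<Rightarrow> ennreal" where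
  "l2_norm_square f = (\<integral>\<^sup>+x. abs_square (f x) \<partial>lborel)"

text \<open>Membership of a random function in \<open>\<S>\<^sup>2(L\<^sup>2(\<real>\<^sup>d))\<close>. Elements of \<open>L\<^sup>2\<close> are finite almost
  everywhere, so differences may be formed after \<open>real_of_ereal\<close>.\<close>

definition in_S2_L2 ::
  "'w measure \<Rightarrow> (real \<Rightarrow> 'w \<Rightarrow> real ^ 'm) \<Rightarrow> real \<Rightarrow> ('w \<Rightarrow> real \<Rightarrow> real ^ 'd \<Rightarrow> ereal) \<Rightarrow> bool"
  where
  "in_S2_L2 M W T u \<longleftrightarrow>
     predictable_version M W T u \<and>
     (AE \<omega> in M. \<forall>t\<in>{0..T}.
        u \<omega> t \<in> borel_measurable borel \<and> l2_norm_square (u \<omega> t) < \<infinity> \<and>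
        ((\<lambda>r. l2_norm_square (\<lambda>x. ereal (real_of_ereal (u \<omega> r x) - real_of_ereal (u \<omega> t x))))
           \<longlongrightarrow> 0) (at t within {0..T})) \<and>
     (\<integral>\<^sup>+\<omega>. (SUP t\<in>{0..T}. l2_norm_square (u \<omega> t)) \<partial>M) < \<infinity>"

section \<open>Quasi-continuity and regular potentials\<close>

text \<open>In the following definitions \<open>X\<close> stands for the process \<open>X\<^sup>\<sigma>\<close>, through which alone they
  depend on \<open>\<sigma>\<close>. The set of all \<open>(\<omega>, x)\<close> for which the path \<open>t \<mapsto> x + X\<^sup>\<sigma>\<^sub>t(\<omega>)\<close> hits \<open>D\<close> is a
  projection; it is measured by the outer measure of \<open>\<P> \<otimes> dx\<close>, which agrees with the completion
  of \<open>\<P> \<otimes> dx\<close>.\<close>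

definition quasi_continuous ::
  "'w measure \<Rightarrow> (real \<Rightarrow> 'w \<Rightarrow> real ^ 'm) \<Rightarrow> real \<Rightarrow> (real \<Rightarrow> 'w \<Rightarrow> real ^ 'd)
     \<Rightarrow> ('w \<Rightarrow> real \<Rightarrow> real ^ 'd \<Rightarrow> ereal) \<Rightarrow> bool" where
  "quasi_continuous M W T X u \<longleftrightarrow>
     (\<forall>\<epsilon>>0. \<exists>D \<in> sets (predictable_sigma M W T \<Otimes>\<^sub>M borel).
        (AE \<omega> in M.
           openin (top_of_set ({0..T} \<times> UNIV)) {(t, x). ((\<omega>, t), x) \<in> D} \<and>
           continuous_on ({0..T} \<times> UNIV - {(t, x). ((\<omega>, t), x) \<in> D}) (\<lambda>(t, x). u \<omega> t x)) \<and>
        outer_measure_of (M \<Otimes>\<^sub>M lborel)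
          {(\<omega>, x). \<omega> \<in> space M \<and> (\<exists>t\<in>{0..T}. ((\<omega>, t), x + X t \<omega>) \<in> D)} \<le> ennreal \<epsilon>)"

definition P_sigma ::
  "'w measure \<Rightarrow> (real \<Rightarrow> 'w \<Rightarrow> real ^ 'm) \<Rightarrow> real \<Rightarrow> (real \<Rightarrow> 'w \<Rightarrow> real ^ 'd)
     \<Rightarrow> real \<Rightarrow> ('w \<Rightarrow> real \<Rightarrow> real ^ 'd \<Rightarrow> ereal) \<Rightarrow> 'w \<Rightarrow> real \<Rightarrow> real ^ 'd \<Rightarrow> real" where
  "P_sigma M W T X s u \<omega> t x =
     (if t + s \<le> T then
        real_cond_exp M (augmented_filtration M W t)
          (\<lambda>\<omega>'. real_of_ereal (u \<omega>' (t + s) (x + X (t + s) \<omega>' - X t \<omega>'))) \<omega>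
      else 0)"

text \<open>For each \<open>x\<close> the conditional expectation in \<open>P_sigma\<close> is determined only up to a null set of
  \<open>\<Omega>\<close> depending on \<open>x\<close>, so an inequality holding \<open>\<P> \<otimes> dx\<close>-almost everywhere for its jointly
  measurable version is stated for almost every \<open>x\<close> and then almost every \<open>\<omega>\<close>.\<close>

definition regular_potential ::
  "'w measure \<Rightarrow> (real \<Rightarrow> 'w \<Rightarrow> real ^ 'm) \<Rightarrow> real \<Rightarrow> (real \<Rightarrow> 'w \<Rightarrow> real ^ 'd)
     \<Rightarrow> ('w \<Rightarrow> real \<Rightarrow> real ^ 'd \<Rightarrow> ereal) \<Rightarrow> bool" where
  "regular_potential M W T X u \<longleftrightarrow>
     in_S2_L2 M W T u \<and>
     quasi_continuous M W T X u \<and>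
     (AE \<omega> in M. ((\<lambda>t. l2_norm_square (u \<omega> t)) \<longlongrightarrow> 0) (at_left T)) \<and>
     (\<integral>\<^sup>+\<omega>. (\<integral>\<^sup>+x. (SUP t\<in>{0..T}. abs_square (u \<omega> t (x + X t \<omega>))) \<partial>lborel) \<partial>M) < \<infinity> \<and>
     (\<forall>t\<in>{0..T}. \<forall>s>0. AE x in lborel. AE \<omega> in M. ereal (P_sigma M W T X s u \<omega> t x) \<le> u \<omega> t x)"

end

theory Submission
  imports Defs
begin

text \<open>Write \<open>w\<^sup>X(t, x) = w(t, x + X\<^sub>t)\<close> for a random function \<open>w\<close> read along the translated paths of \<open>X\<close>. The
whole argument rests on one quantity, \<open>gap n = sup\<^sub>t \<bar>u\<^sup>X - v\<^sub>n\<^sup>X\<bar>\<^sup>2\<close>, a function on \<open>\<Omega> \<times> \<real>\<^sup>d\<close>. Quasi-continuity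
makes almost every path \<open>t \<mapsto> v\<^sub>n\<^sup>X(t, x)\<close> continuous, because almost every path avoids one of the
exceptional sets of \<open>v\<^sub>n\<close>. The paths of \<open>u\<^sup>X\<close> are continuous by hypothesis and the
convergence is monotone, so Dini's theorem gives \<open>gap n \<rightarrow> 0\<close> almost everywhere
(\<open>gap_tendsto_0\<close>). The suprema of \<open>\<bar>u\<^sup>X\<bar>\<close> and of the first potential are square integrable, and their squares dominate
the gap up to a factor (\<open>gap_dominated\<close>); hence \<open>gap n \<rightarrow> 0\<close> in \<open>L\<^sup>1(\<Omega> \<times> \<real>\<^sup>d)\<close>, and also in \<open>L\<^sup>1(\<real>\<^sup>d)\<close> for almost every \<open>\<omega>\<close>.

Lebesgue measure is translation invariant, so \<open>\<parallel>u(t) - v\<^sub>n(t)\<parallel>\<^sup>2 \<le> \<integral> gap n dx\<close> for all \<open>t\<close>: the potentials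
converge in \<open>L\<^sup>2\<close> uniformly in time. Both the continuity of \<open>t \<mapsto> u(t)\<close> in \<open>L\<^sup>2\<close> and the vanishing of \<open>u\<close> at the
terminal time are inherited from \<open>v\<^sub>n\<close> under uniform convergence (\<open>u_in_S2_L2\<close>, \<open>u_terminal_value\<close>).

For quasi-continuity (\<open>u_quasi_continuous\<close>), \<open>gap n \<rightarrow> 0\<close> in measure provides indices \<open>m\<^sub>k\<close> for which a gap of size
\<open>4\<^sup>-\<^sup>k\<close> is unlikely. The exceptional set for \<open>u\<close> is the union of the exceptional sets of all \<open>v\<^sub>n\<close> and of the sets
where some \<open>v\<^sub>n\<close> exceeds \<open>v\<^bsub>m\<^sub>k\<^esub>\<close> by more than \<open>2\<^sup>-\<^sup>k\<close>. It is open because \<open>v\<^sub>n\<close> and \<open>v\<^bsub>m\<^sub>k\<^esub>\<close> are continuous off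
their exceptional sets; off the union, \<open>v\<^bsub>m\<^sub>k\<^esub>\<close> converges to \<open>u\<close> uniformly, so \<open>u\<close> is continuous there. The functions
may be infinite at points of \<open>[0,T] \<times> \<real>\<^sup>d\<close>, and differences are therefore taken after applying the arctangent,
extended to \<open>[-\<infinity>, \<infinity>]\<close>.

Finally, for almost every \<open>x\<close> the random variables in the definition of \<open>P_sigma\<close> converge monotonically in
\<open>L\<^sup>1(\<Omega>)\<close>, and an upper bound for conditional expectations survives such a limit
(\<open>real_cond_exp_le_of_L1_limit\<close>, \<open>u_P_sigma_le\<close>).\<close>

section \<open>An order embedding of the extended reals into a bounded interval\<close>

text \<open>The arctangent, extended to the two-point compactification: a bounded order embedding that is
  1-Lipschitz on the reals and makes uniform distances between extended real functions available.\<close>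

definition compress :: "ereal \<Rightarrow> real" where
  "compress y = (if y = \<infinity> then pi / 2 else if y = -\<infinity> then - pi / 2 else arctan (real_of_ereal y))"

lemma compress_simps [simp]:
  "compress \<infinity> = pi / 2" "compress (-\<infinity>) = - pi / 2" "compress (ereal r) = arctan r"
  by (simp_all add: compress_def)

lemma compress_less_iff [simp]: "compress a < compress b \<longleftrightarrow> a < b"
proof -
  have "- pi / 2 < arctan r" "arctan r < pi / 2" for r using arctan_bounded[of r] by auto
  then show ?thesis
    by (cases a; cases b) (auto simp: arctan_less_iff not_less intro: less_imp_le less_trans)
qed

lemma compress_le_iff [simp]: "compress a \<le> compress b \<longleftrightarrow> a \<le> b"
  by (meson compress_less_iff linorder_not_less)

lemma compress_eq_iff [simp]: "compress a = compress b \<longleftrightarrow> a = b"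
  by (metis compress_le_iff order_antisym order_refl)

lemma compress_bounds: "- pi / 2 \<le> compress y" "compress y \<le> pi / 2"
  using compress_le_iff[of "-\<infinity>" y] compress_le_iff[of y \<infinity>] by (simp_all del: compress_le_iff)

lemma compress_surj:
  assumes "- pi / 2 \<le> c" "c \<le> pi / 2"
  obtains z where "compress z = c"
proof -
  consider "c = - pi / 2" | "c = pi / 2" | "- pi / 2 < c" "c < pi / 2" using assms by linarith
  then have "\<exists>z. compress z = c"
  proof cases
    case 1 then show ?thesis by (intro exI[of _ "-\<infinity>"]) simp
  next
    case 2 then show ?thesis by (intro exI[of _ \<infinity>]) simp
  next
    case 3 then show ?thesis by (intro exI[of _ "ereal (tan c)"]) (simp add: arctan_tan)
  qed
  then show thesis using that by blast
qed

text \<open>The derivative of the arctangent is at most 1.\<close>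

lemma compress_diff_le:
  assumes "\<bar>a\<bar> \<noteq> \<infinity>" "\<bar>b\<bar> \<noteq> \<infinity>"
  shows "\<bar>compress a - compress b\<bar> \<le> \<bar>real_of_ereal a - real_of_ereal b\<bar>"
proof -
  have *: "\<bar>arctan x - arctan y\<bar> \<le> \<bar>x - y\<bar>" if xy: "y < x" for x y
  proof -
    obtain z where z: "arctan x - arctan y = (x - y) * (inverse (1 + z\<^sup>2))"
      using MVT2[OF xy, of arctan "\<lambda>z. inverse (1 + z\<^sup>2)"] DERIV_arctan by blast
    have "inverse (1 + z\<^sup>2) \<le> 1" "0 \<le> inverse (1 + z\<^sup>2)"
      by (auto simp: inverse_le_1_iff add_nonneg_nonneg)
    then show ?thesis using xy unfolding z by (simp add: abs_mult mult_left_le)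
  qed
  then have "\<bar>arctan x - arctan y\<bar> \<le> \<bar>x - y\<bar>" for x y
    using *[of y x] *[of x y] by (cases x y rule: linorder_cases) (auto simp: abs_minus_commute)
  then show ?thesis using assms by (cases a; cases b) auto
qed

text \<open>A monotone map onto an interval has no jumps.\<close>

lemma continuous_on_compress: "continuous_on A compress"
proof -
  have "(compress \<longlongrightarrow> compress y) (at y)" for y
  proof (rule order_tendstoI)
    fix c assume c: "c < compress y"
    show "\<forall>\<^sub>F w in at y. c < compress w"
    proof (cases "- pi / 2 \<le> c")
      case True
      then obtain z where z: "compress z = c"
        using compress_surj[of c] c compress_bounds(2)[of y] by (metis less_imp_le order_trans)
      then have "z < y" using c by (metis compress_less_iff)
      then have "\<forall>\<^sub>F w in at y. z < w" by (rule order_tendstoD(1)[OF tendsto_ident_at])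
      then show ?thesis by eventually_elim (simp flip: z)
    next
      case False
      then have "c < compress w" for w using compress_bounds(1)[of w] by linarith
      then show ?thesis by simp
    qed
  next
    fix c assume c: "compress y < c"
    show "\<forall>\<^sub>F w in at y. compress w < c"
    proof (cases "c \<le> pi / 2")
      case True
      then obtain z where z: "compress z = c"
        using compress_surj[of c] c compress_bounds(1)[of y] by (metis less_imp_le order_trans)
      then have "y < z" using c by (metis compress_less_iff)
      then have "\<forall>\<^sub>F w in at y. w < z" by (rule order_tendstoD(2)[OF tendsto_ident_at])
      then show ?thesis by eventually_elim (simp flip: z)
    next
      case False
      then have "compress w < c" for w using compress_bounds(2)[of w] by linarith
      then show ?thesis by simp
    qed
  qed
  then show ?thesis
    unfolding continuous_on_def by (blast intro: tendsto_within_subset[OF _ subset_UNIV])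
qed

text \<open>The extended reals are compact, so the continuous injection \<open>compress\<close> is a homeomorphism onto its image.\<close>

lemma continuous_on_compress_comp_iff:
  "continuous_on A (\<lambda>z. compress (f z)) \<longleftrightarrow> continuous_on A f"
proof
  assume f: "continuous_on A (\<lambda>z. compress (f z))"
  have g: "continuous_on (range compress) (inv compress)"
    by (rule continuous_on_inv[OF continuous_on_compress compact_UNIV])
      (simp add: inj_def)
  have "continuous_on A (\<lambda>z. inv compress (compress (f z)))"
    using continuous_on_compose2[OF g f] by auto
  then show "continuous_on A f" by (simp add: inj_def)
qed (auto intro: continuous_on_compose2[OF continuous_on_compress[of UNIV]])

lemma borel_measurable_compress [measurable]: "compress \<in> borel_measurable borel"
  by (intro borel_measurable_continuous_onI continuous_on_compress)

section \<open>Uniform convergence, superlevel sets and suprema\<close>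

text \<open>Dini's theorem: for \<open>e > 0\<close> the compact sets on which \<open>f n\<close> stays \<open>e\<close> below the limit decrease to the
empty set, so one of them is already empty.\<close>

lemma Dini_uniform_limit:
  fixes f :: "nat \<Rightarrow> 'a::heine_borel \<Rightarrow> real"
  assumes K: "compact K" and f: "\<And>n. continuous_on K (f n)" and g: "continuous_on K g"
    and mono: "\<And>n x. x \<in> K \<Longrightarrow> f n x \<le> f (Suc n) x"
    and lim: "\<And>x. x \<in> K \<Longrightarrow> (\<lambda>n. f n x) \<longlonglongrightarrow> g x"
  shows "uniform_limit K f g sequentially"
proof (rule uniform_limitI)
  fix e :: real assume "0 < e"
  define F where "F n = {x \<in> K. e \<le> g x - f n x}" for n
  have mono': "f m x \<le> f n x" if "x \<in> K" "m \<le> n" for m n x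
    by (rule lift_Suc_mono_le[of "\<lambda>n. f n x"]) (use that mono in auto)
  have le: "f n x \<le> g x" if "x \<in> K" for n x
    by (rule incseq_le[OF incseq_SucI lim[OF that]]) (rule mono[OF that])
  have comp: "compact (F n)" for n
  proof -
    have c: "continuous_on K (\<lambda>x. g x - f n x)" by (intro continuous_intros f g)
    have "F n = K \<inter> (\<lambda>x. g x - f n x) -` {e..}" by (auto simp: F_def)
    then have "closed (F n)"
      using continuous_closed_preimage[OF c compact_imp_closed[OF K] closed_atLeast] by simp
    then have "compact (K \<inter> F n)" by (rule compact_Int_closed[OF K])
    then show ?thesis by (simp add: F_def Int_def conj_assoc[symmetric])
  qed
  have nest: "F n \<subseteq> F m" if "m \<le> n" for m n
    using mono'[OF _ that] by (fastforce simp: F_def)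
  have "\<exists>n. F n = {}"
  proof (rule ccontr)
    assume *: "\<nexists>n. F n = {}"
    obtain x where x: "x \<in> (\<Inter>n. F n)"
      using compact_nest[of F] comp * nest by blast
    then have "x \<in> K" by (auto simp: F_def)
    then have "(\<lambda>n. g x - f n x) \<longlonglongrightarrow> g x - g x" by (intro tendsto_intros lim)
    then have "eventually (\<lambda>n. g x - f n x < e) sequentially"
      using \<open>0 < e\<close> by (intro order_tendstoD) auto
    then obtain n where "g x - f n x < e" by (auto simp: eventually_sequentially)
    moreover have "e \<le> g x - f n x" using x by (auto simp: F_def)
    ultimately show False by simp
  qed
  then obtain N where N: "F N = {}" by blast
  show "\<forall>\<^sub>F n in sequentially. \<forall>x\<in>K. dist (f n x) (g x) < e"
    using eventually_ge_at_top[of N]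
  proof eventually_elim
    case (elim n)
    then have "F n = {}" using nest[OF elim] N by blast
    then show ?case using le by (force simp: F_def dist_real_def)
  qed
qed

text \<open>The complement of the union in \<open>S\<close> is the sublevel set of \<open>f\<close> in the closed set \<open>S - A\<close>, on which
\<open>f\<close> is continuous.\<close>

lemma openin_Un_superlevel:
  fixes f :: "'a::topological_space \<Rightarrow> real"
  assumes A: "openin (top_of_set S) A" and f: "continuous_on (S - A) f"
  shows "openin (top_of_set S) (A \<union> {z \<in> S. c < f z})"
proof -
  have "closedin (top_of_set (S - A)) ((S - A) \<inter> f -` {..c})"
    by (rule continuous_closedin_preimage[OF f closed_atMost])
  moreover have "closedin (top_of_set S) (S - A)" using A by (intro closedin_diff) auto
  ultimately have "closedin (top_of_set S) ((S - A) \<inter> f -` {..c})" by (rule closedin_trans)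
  then have "openin (top_of_set S) (S - ((S - A) \<inter> f -` {..c}))" by (intro openin_diff) auto
  moreover have "S - ((S - A) \<inter> f -` {..c}) = A \<union> {z \<in> S. c < f z}"
    using openin_imp_subset[OF A] by auto
  ultimately show ?thesis by simp
qed

text \<open>Suprema over \<open>[0,T]\<close> of continuous paths reduce to countable ones by this lemma, and so become measurable.\<close>

lemma SUP_dense_eq:
  fixes g :: "'a::metric_space \<Rightarrow> 'b::{complete_linorder, linorder_topology}"
  assumes "Q \<subseteq> S" "S \<subseteq> closure Q" and g: "continuous_on S g"
  shows "(SUP t\<in>S. g t) = (SUP t\<in>Q. g t)"
proof (rule antisym)
  show "(SUP t\<in>S. g t) \<le> (SUP t\<in>Q. g t)"
  proof (rule SUP_least)
    fix t assume t: "t \<in> S"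
    then obtain q where q: "\<And>n. q n \<in> Q" "q \<longlonglongrightarrow> t"
      using assms(2) closure_sequential by (metis subsetD)
    then have "(\<lambda>n. g (q n)) \<longlonglongrightarrow> g t"
      by (intro continuous_on_tendsto_compose[OF g]) (use t q subsetD[OF assms(1)] in auto)
    then show "g t \<le> (SUP t\<in>Q. g t)"
      by (rule LIMSEQ_le_const2) (auto intro: SUP_upper q)
  qed
qed (rule SUP_subset_mono[OF assms(1) order_refl])

text \<open>Limits interchange under uniform approximation: \<open>\<rho> n\<close> bounds the error of the \<open>n\<close>-th approximation, uniformly in \<open>t\<close>.
The constant 6 covers both \<open>l2_diff_triangle\<close> and \<open>l2_norm_square_le_diff\<close> below.\<close>

lemma tendsto_0_of_approximation:
  fixes d :: "'a \<Rightarrow> ennreal"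
  assumes le: "\<And>n. \<forall>\<^sub>F t in F. d t \<le> 6 * (\<rho> n + e n t)"
    and \<rho>: "\<rho> \<longlonglongrightarrow> 0" and e: "\<And>n. (e n \<longlongrightarrow> 0) F"
  shows "(d \<longlongrightarrow> 0) F"
proof (rule tendsto_zero_ennreal)
  fix r :: real assume r: "0 < r"
  have "\<forall>\<^sub>F n in sequentially. \<rho> n < ennreal (r / 24)"
    using r by (intro order_tendstoD(2)[OF \<rho>]) auto
  then obtain n where n: "\<rho> n < ennreal (r / 24)" by (auto simp: eventually_sequentially)
  have "\<forall>\<^sub>F t in F. e n t < ennreal (r / 24)" using r by (intro order_tendstoD(2)[OF e]) auto
  with le[of n] show "\<forall>\<^sub>F t in F. d t < ennreal r"
  proof eventually_elim
    case (elim t)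
    have "d t \<le> 6 * (ennreal (r / 24) + ennreal (r / 24))"
      using n elim by (elim order_trans) (intro mult_left_mono add_mono less_imp_le; simp)
    also have "\<dots> = ennreal (6 * (r / 24 + r / 24))"
      using r by (simp add: ennreal_plus[symmetric] ennreal_mult[symmetric] flip: ennreal_numeral
          del: ennreal_plus)
    also have "\<dots> < ennreal r" using r by (simp add: ennreal_less_iff)
    finally show ?case .
  qed
qed

lemma continuous_on_real_of_ereal_comp:
  assumes f: "continuous_on A f" and fin: "\<And>t. t \<in> A \<Longrightarrow> \<bar>f t\<bar> \<noteq> \<infinity>"
  shows "continuous_on A (\<lambda>t. real_of_ereal (f t))"
  unfolding continuous_on_def
proof
  fix t assume t: "t \<in> A"
  then have "(f \<longlongrightarrow> ereal (real_of_ereal (f t))) (at t within A)"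
    using f fin by (simp add: continuous_on_def ereal_real')
  then show "((\<lambda>t. real_of_ereal (f t)) \<longlongrightarrow> real_of_ereal (f t)) (at t within A)"
    by (rule lim_real_of_ereal)
qed

section \<open>Squares and mean square distances\<close>

lemma abs_square_ereal [simp]: "abs_square (ereal r) = ennreal (r\<^sup>2)"
  by (simp add: abs_square_def ennreal_power)

lemma abs_square_infinity [simp]: "abs_square \<infinity> = \<infinity>" "abs_square (-\<infinity>) = \<infinity>"
  by (simp_all add: abs_square_def e2ennreal_infty power2_eq_square ennreal_top_mult)

lemma abs_square_top_iff: "abs_square y = \<infinity> \<longleftrightarrow> \<bar>y\<bar> = \<infinity>"
  by (cases y) auto

lemma borel_measurable_abs_square [measurable]: "abs_square \<in> borel_measurable borel"
  unfolding abs_square_def by measurable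

lemma tendsto_abs_square: 
  assumes "(f \<longlongrightarrow> l) F" shows "((\<lambda>x. abs_square (f x)) \<longlongrightarrow> abs_square l) F"
proof -
  have abs: "((\<lambda>x. \<bar>f x\<bar>) \<longlongrightarrow> \<bar>l\<bar>) F" by (rule tendsto_abs_ereal[OF assms])
  have "((\<lambda>x. e2ennreal \<bar>f x\<bar>) \<longlongrightarrow> e2ennreal \<bar>l\<bar>) F"
    by (rule continuous_on_tendsto_compose[OF continuous_on_e2ennreal[of UNIV] abs]) auto
  then have "((\<lambda>x. e2ennreal \<bar>f x\<bar> * e2ennreal \<bar>f x\<bar>) \<longlongrightarrow> e2ennreal \<bar>l\<bar> * e2ennreal \<bar>l\<bar>) F"
    by (intro tendsto_mult_ennreal) auto
  then show ?thesis by (simp add: abs_square_def power2_eq_square)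
qed

text \<open>For \<open>c = v 0\<close>, \<open>b = v n\<close> and \<open>a = u\<close> the bound is independent of \<open>n\<close>: this is the domination of the gaps below.\<close>

lemma square_diff_le:
  fixes a b c :: ereal
  assumes "c \<le> b" "b \<le> a" "abs_square a \<le> B" "abs_square c \<le> B" "B < \<infinity>"
  shows "\<bar>a\<bar> \<noteq> \<infinity>" "\<bar>b\<bar> \<noteq> \<infinity>" "ennreal ((real_of_ereal a - real_of_ereal b)\<^sup>2) \<le> 4 * B"
proof -
  have f: "\<bar>a\<bar> \<noteq> \<infinity>" "\<bar>c\<bar> \<noteq> \<infinity>" using assms by (auto simp flip: abs_square_top_iff)
  then obtain x z where xz: "a = ereal x" "c = ereal z" by auto
  then obtain y where y: "b = ereal y" using assms(1,2) by (cases b) auto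
  show "\<bar>a\<bar> \<noteq> \<infinity>" "\<bar>b\<bar> \<noteq> \<infinity>" using xz y by auto
  have "(x - y)\<^sup>2 \<le> (x - z)\<^sup>2" using assms(1,2) xz y by (intro power_mono) auto
  also have "\<dots> \<le> 2 * x\<^sup>2 + 2 * z\<^sup>2"
    using zero_le_power2[of "x + z"] by (simp add: power2_eq_square algebra_simps)
  finally have "ennreal ((x - y)\<^sup>2) \<le> ennreal (2 * x\<^sup>2 + 2 * z\<^sup>2)" by (rule ennreal_leI)
  also have "\<dots> = 2 * abs_square a + 2 * abs_square c"
    by (simp add: xz ennreal_plus ennreal_mult)
  also have "\<dots> \<le> 2 * B + 2 * B" using assms by (intro add_mono mult_left_mono) auto
  also have "\<dots> = 4 * B" by (simp flip: distrib_right)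
  finally show "ennreal ((real_of_ereal a - real_of_ereal b)\<^sup>2) \<le> 4 * B" by (simp add: xz y)
qed

lemma nn_integral_lborel_translate:
  fixes f :: "real ^ 'd \<Rightarrow> ennreal"
  assumes [measurable]: "f \<in> borel_measurable borel"
  shows "(\<integral>\<^sup>+x. f (x + a) \<partial>lborel) = (\<integral>\<^sup>+x. f x \<partial>lborel)"
proof -
  have "(\<integral>\<^sup>+x. f x \<partial>lborel) = (\<integral>\<^sup>+x. f x \<partial>distr lborel borel ((+) a))"
    by (simp add: lborel_distr_plus)
  also have "\<dots> = (\<integral>\<^sup>+x. f (x + a) \<partial>lborel)"
    by (subst nn_integral_distr) (auto simp: add.commute)
  finally show ?thesis ..
qed

lemma l2_norm_square_translate:
  assumes [measurable]: "f \<in> borel_measurable borel"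
  shows "l2_norm_square f = (\<integral>\<^sup>+x. abs_square (f (x + a)) \<partial>lborel)"
  unfolding l2_norm_square_def 
  by (rule nn_integral_lborel_translate[symmetric, where f="\<lambda>x. abs_square (f x)"]) simp

text \<open>The path \<open>f \<rightarrow> f' \<rightarrow> g' \<rightarrow> g\<close> consists of three steps, of which the first and the last have square
norm at most \<open>\<rho>\<close>.\<close>

lemma l2_diff_triangle:
  fixes f g f' g' :: "real ^ 'd \<Rightarrow> ereal"
  assumes [measurable]: "f \<in> borel_measurable borel" "g \<in> borel_measurable borel"
    "f' \<in> borel_measurable borel" "g' \<in> borel_measurable borel"
    and f: "l2_norm_square (\<lambda>x. ereal (real_of_ereal (f x) - real_of_ereal (f' x))) \<le> \<rho>"
    and g: "l2_norm_square (\<lambda>x. ereal (real_of_ereal (g x) - real_of_ereal (g' x))) \<le> \<rho>"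
  shows "l2_norm_square (\<lambda>x. ereal (real_of_ereal (f x) - real_of_ereal (g x))) \<le>
    6 * (\<rho> + l2_norm_square (\<lambda>x. ereal (real_of_ereal (f' x) - real_of_ereal (g' x))))"
proof -
  let ?d = "\<lambda>f g x. ennreal ((real_of_ereal (f x) - real_of_ereal (g x))\<^sup>2)"
  \<comment> \<open>\<open>a - b = p - q + r\<close> with \<open>p = a - a'\<close>, \<open>q = b - b'\<close>, \<open>r = a' - b'\<close>; the defect in the inequality is a sum of squares\<close>
  have sq: "(a - b)\<^sup>2 \<le> 3 * ((a - a')\<^sup>2 + (b - b')\<^sup>2 + (a' - b')\<^sup>2)" for a b a' b' :: real
  proof -
    have "3 * ((a - a')\<^sup>2 + (b - b')\<^sup>2 + (a' - b')\<^sup>2) - (a - b)\<^sup>2 =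
      ((a - a') + (b - b'))\<^sup>2 + ((a - a') - (a' - b'))\<^sup>2 + ((b - b') + (a' - b'))\<^sup>2"
      by (simp add: power2_eq_square algebra_simps)
    then show ?thesis by (smt (verit) zero_le_power2)
  qed
  have "?d f g x \<le> 3 * (?d f f' x + ?d g g' x + ?d f' g' x)" for x
    using sq[of "real_of_ereal (f x)" "real_of_ereal (g x)" "real_of_ereal (f' x)" "real_of_ereal (g' x)"]
    by (simp add: ennreal_leI ennreal_plus[symmetric] ennreal_mult[symmetric] flip: ennreal_numeral del: ennreal_plus)
  then have "(\<integral>\<^sup>+x. ?d f g x \<partial>lborel) \<le> (\<integral>\<^sup>+x. 3 * (?d f f' x + ?d g g' x + ?d f' g' x) \<partial>lborel)"
    by (intro nn_integral_mono) auto
  also have "\<dots> = 3 * ((\<integral>\<^sup>+x. ?d f f' x \<partial>lborel) + (\<integral>\<^sup>+x. ?d g g' x \<partial>lborel) + (\<integral>\<^sup>+x. ?d f' g' x \<partial>lborel))"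
    by (simp add: nn_integral_cmult nn_integral_add)
  also have "\<dots> \<le> 3 * (\<rho> + \<rho> + (\<integral>\<^sup>+x. ?d f' g' x \<partial>lborel))"
    using f g by (intro mult_left_mono add_mono) (auto simp: l2_norm_square_def)
  also have "\<dots> \<le> 3 * (2 * \<rho> + 2 * (\<integral>\<^sup>+x. ?d f' g' x \<partial>lborel))"
  proof (intro mult_left_mono add_mono)
    show "\<rho> + \<rho> \<le> 2 * \<rho>" by (simp add: mult_2)
    show "(\<integral>\<^sup>+x. ?d f' g' x \<partial>lborel) \<le> 2 * (\<integral>\<^sup>+x. ?d f' g' x \<partial>lborel)"
      by (simp add: mult_2)
  qed auto
  also have "\<dots> = 6 * (\<rho> + (\<integral>\<^sup>+x. ?d f' g' x \<partial>lborel))" by (simp add: distrib_left mult.assoc[symmetric])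
  finally show ?thesis by (simp add: l2_norm_square_def)
qed

text \<open>Finiteness of the norm of \<open>f\<close> is essential: \<open>real_of_ereal\<close> sends \<open>\<infinity>\<close> to 0, so the difference would not
see the infinite values of \<open>f\<close>.\<close>

lemma l2_norm_square_le_diff:
  fixes f g :: "real ^ 'd \<Rightarrow> ereal"
  assumes [measurable]: "f \<in> borel_measurable borel" "g \<in> borel_measurable borel"
    and fin: "l2_norm_square f < \<infinity>"
    and diff: "l2_norm_square (\<lambda>x. ereal (real_of_ereal (f x) - real_of_ereal (g x))) \<le> \<rho>"
  shows "l2_norm_square f \<le> 6 * (\<rho> + l2_norm_square g)"
proof -
  let ?d = "\<lambda>x. ennreal ((real_of_ereal (f x) - real_of_ereal (g x))\<^sup>2)"
  have sq: "a\<^sup>2 \<le> 2 * ((a - b)\<^sup>2 + b\<^sup>2)" for a b :: real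
  proof -
    have "2 * ((a - b)\<^sup>2 + b\<^sup>2) - a\<^sup>2 = (a - 2 * b)\<^sup>2" by (simp add: power2_eq_square algebra_simps)
    then show ?thesis by (smt (verit) zero_le_power2)
  qed
  have "AE x in lborel. abs_square (f x) \<noteq> \<infinity>"
    using fin by (intro nn_integral_PInf_AE) (auto simp: l2_norm_square_def)
  then have "AE x in lborel. abs_square (f x) \<le> 2 * (?d x + abs_square (g x))"
  proof eventually_elim
    case (elim x)
    then obtain a where a: "f x = ereal a" by (cases "f x") auto
    show ?case
    proof (cases "g x")
      case (real b)
      then show ?thesis using sq[of a b] 
        by (simp add: a ennreal_leI ennreal_plus[symmetric] ennreal_mult[symmetric] flip: ennreal_numeral del: ennreal_plus)
    qed (simp_all add: a ennreal_mult_top)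
  qed
  then have "l2_norm_square f \<le> (\<integral>\<^sup>+x. 2 * (?d x + abs_square (g x)) \<partial>lborel)"
    unfolding l2_norm_square_def by (rule nn_integral_mono_AE)
  also have "\<dots> = 2 * ((\<integral>\<^sup>+x. ?d x \<partial>lborel) + l2_norm_square g)"
    by (simp add: nn_integral_cmult nn_integral_add l2_norm_square_def)
  also have "\<dots> \<le> 6 * (\<rho> + l2_norm_square g)"
    using diff by (intro mult_mono add_mono) (auto simp: l2_norm_square_def)
  finally show ?thesis .
qed

section \<open>Conditional expectations of limits\<close>

text \<open>Conditional expectation preserves the integral of \<open>f - fn n \<ge> 0\<close>. Hence the infimum over \<open>n\<close> of the
conditional expectations of \<open>f - fn n\<close> has integral 0 and vanishes almost everywhere.\<close>

lemma (in sigma_finite_subalgebra) real_cond_exp_le_of_L1_limit: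
  fixes g :: "'a \<Rightarrow> ereal"
  assumes f [measurable]: "integrable M f" and fn [measurable]: "\<And>n. integrable M (fn n)"
    and le: "\<And>n. AE x in M. fn n x \<le> f x"
    and lim: "(\<lambda>n. \<integral>\<^sup>+x. ennreal (f x - fn n x) \<partial>M) \<longlonglongrightarrow> 0"
    and g: "\<And>n. AE x in M. ereal (real_cond_exp M F (fn n) x) \<le> g x"
  shows "AE x in M. ereal (real_cond_exp M F f x) \<le> g x"
proof -
  define h where "h n = real_cond_exp M F (\<lambda>x. f x - fn n x)" for n
  have [measurable]: "h n \<in> borel_measurable M" for n by (simp add: h_def)
  have int: "integrable M (\<lambda>x. f x - fn n x)" for n using f fn by simp
  have pos: "AE x in M. 0 \<le> h n x" for n
    unfolding h_def using le[of n] by (intro real_cond_exp_pos) (auto elim: AE_mp)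
  have eq: "(\<integral>\<^sup>+x. ennreal (h n x) \<partial>M) = (\<integral>\<^sup>+x. ennreal (f x - fn n x) \<partial>M)" for n
  proof -
    have "(\<integral>\<^sup>+x. ennreal (h n x) \<partial>M) = ennreal (\<integral>x. h n x \<partial>M)"
      by (rule nn_integral_eq_integral) (use pos int in \<open>auto simp: h_def\<close>)
    also have "\<dots> = ennreal (\<integral>x. f x - fn n x \<partial>M)"
      unfolding h_def using real_cond_exp_int(2)[OF int] by simp
    also have "\<dots> = (\<integral>\<^sup>+x. ennreal (f x - fn n x) \<partial>M)"
      by (rule nn_integral_eq_integral[symmetric]) (use le[of n] int in auto)
    finally show ?thesis .
  qed
  have "(\<integral>\<^sup>+x. (INF n. ennreal (h n x)) \<partial>M) \<le> (\<integral>\<^sup>+x. ennreal (f x - fn n x) \<partial>M)" for n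
    unfolding eq[symmetric] by (intro nn_integral_mono INF_lower) auto
  then have "(\<integral>\<^sup>+x. (INF n. ennreal (h n x)) \<partial>M) \<le> 0"
    by (intro LIMSEQ_le_const[OF lim]) auto
  then have "(\<integral>\<^sup>+x. (INF n. ennreal (h n x)) \<partial>M) = 0" by simp
  then have zero: "AE x in M. (INF n. ennreal (h n x)) = 0"
    by (subst (asm) nn_integral_0_iff_AE) auto
  have diff: "AE x in M. \<forall>n. h n x = real_cond_exp M F f x - real_cond_exp M F (fn n) x"
    unfolding h_def AE_all_countable using real_cond_exp_diff[OF f fn] by auto
  have "AE x in M. \<forall>n. 0 \<le> h n x" "AE x in M. \<forall>n. ereal (real_cond_exp M F (fn n) x) \<le> g x"
    unfolding AE_all_countable using pos g by auto
  with zero diff show ?thesis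
  proof eventually_elim
    case (elim x)
    show ?case
    proof (rule ereal_le_epsilon2)
      fix e :: real assume "0 < e"
      then have "(INF n. ennreal (h n x)) < ennreal e" using elim by simp
      then obtain n where "ennreal (h n x) < ennreal e" by (auto simp: INF_less_iff)
      then have "h n x < e" using elim by (simp add: ennreal_less_iff)
      then have "ereal (real_cond_exp M F f x) \<le> ereal (real_cond_exp M F (fn n) x) + ereal e"
        using elim by auto
      also have "\<dots> \<le> g x + ereal e" using elim by (intro add_right_mono) auto
      finally show "ereal (real_cond_exp M F f x) \<le> g x + ereal e" .
    qed
  qed
qed

text \<open>The random variables inside \<open>P_sigma\<close> agree only almost everywhere with sections of a predictable version;
completeness turns this into measurability.\<close>

lemma (in complete_measure) measurable_cong_AE_complete:
  assumes g: "g \<in> measurable M N" and f: "\<And>x. x \<in> space M \<Longrightarrow> f x \<in> space N"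
    and eq: "AE x in M. f x = g x"
  shows "f \<in> measurable M N"
proof (rule measurableI)
  fix A assume "A \<in> sets N"
  then have "g -` A \<inter> space M \<in> sets M" by (rule measurable_sets[OF g])
  then show "f -` A \<inter> space M \<in> sets M"
    by (rule in_sets_AE[rotated]) (use eq in \<open>auto elim!: eventually_mono\<close>)
qed (rule f)

section \<open>Translation along a continuous adapted process\<close>

text \<open>The translations act along an arbitrary continuous adapted process \<open>X\<close>. Measurability of \<open>W\<close> places its augmented
filtration inside \<open>M\<close>, and completeness of \<open>M\<close> lets measurability pass to almost everywhere equal functions.\<close>

locale random_translation = prob_space M + complete_measure M
  for M :: "'w measure" +
  fixes W :: "real \<Rightarrow> 'w \<Rightarrow> real ^ 'm" and T :: real and X :: "real \<Rightarrow> 'w \<Rightarrow> real ^ 'd"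
  assumes W_measurable: "\<And>s. 0 \<le> s \<Longrightarrow> W s \<in> borel_measurable M"
    and T_pos: "0 < T"
    and X_adapted: "\<And>t. t \<in> {0..T} \<Longrightarrow> X t \<in> borel_measurable (augmented_filtration M W t)"
    and X_continuous: "AE \<omega> in M. continuous_on {0..T} (\<lambda>t. X t \<omega>)"
begin

sublocale product: pair_sigma_finite M "lborel :: (real ^ 'd) measure" ..

lemma subalgebra_filtration: "subalgebra M (augmented_filtration M W t)"
proof -
  let ?G = "{W s -` B \<inter> space M | s B. 0 \<le> s \<and> s \<le> t \<and> B \<in> sets borel} \<union> null_sets M"
  have G: "?G \<subseteq> sets M" using W_measurable by (auto intro: measurable_sets)
  then have "?G \<subseteq> Pow (space M)" using sets.space_closed by blast
  then show ?thesis
    unfolding subalgebra_def augmented_filtration_def 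
    using sets.sigma_sets_subset[OF G] by (simp add: space_measure_of_conv sets_measure_of)
qed

lemma X_measurable [measurable]: "t \<in> {0..T} \<Longrightarrow> X t \<in> borel_measurable M"
  using measurable_from_subalg[OF subalgebra_filtration X_adapted] .

lemma predictable_generator_subset:
  "{A \<times> {0} | A. A \<in> sets (augmented_filtration M W 0)} \<union>
      {A \<times> {s<..t} | A s t. 0 \<le> s \<and> s < t \<and> t \<le> T \<and> A \<in> sets (augmented_filtration M W s)}
    \<subseteq> Pow (space M \<times> {0..T})"
proof -
  have "A \<subseteq> space M" if "A \<in> sets (augmented_filtration M W r)" for A r
    using subalgebra_filtration that sets.sets_into_space unfolding subalgebra_def by blast
  then show ?thesis using T_pos by fastforce
qed

lemma space_predictable [simp]: "space (predictable_sigma M W T) = space M \<times> {0..T}"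
  unfolding predictable_sigma_def by (rule space_measure_of[OF predictable_generator_subset])

lemma measurable_at_time:
  assumes "t \<in> {0..T}"
  shows "(\<lambda>\<omega>. (\<omega>, t)) \<in> measurable M (predictable_sigma M W T)"
  unfolding predictable_sigma_def
proof (rule measurable_measure_of[OF predictable_generator_subset], goal_cases)
  case 1
  then show ?case using assms by auto
next
  case (2 y)
  have sub: "A \<in> sets M" "A \<subseteq> space M" if "A \<in> sets (augmented_filtration M W r)" for A r
    using subalgebra_filtration[of r] that sets.sets_into_space unfolding subalgebra_def by blast+
  from 2 obtain A I r where y: "y = A \<times> I" and A: "A \<in> sets (augmented_filtration M W r)" by auto
  have "(\<lambda>\<omega>. (\<omega>, t)) -` y \<inter> space M = (if t \<in> I then A else {})"
    using sub(2)[OF A] by (auto simp: y)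
  then show ?case using sub(1)[OF A] by simp
qed

lemma measurable_evaluation:
  assumes v: "(\<lambda>((\<omega>, t), x). v \<omega> t x) \<in> measurable (predictable_sigma M W T \<Otimes>\<^sub>M borel) N"
    and t: "t \<in> {0..T}" and g [measurable]: "g \<in> borel_measurable (M \<Otimes>\<^sub>M lborel)"
  shows "(\<lambda>z. v (fst z) t (g z)) \<in> measurable (M \<Otimes>\<^sub>M (lborel :: (real ^ 'd) measure)) N"
proof -
  note [measurable] = measurable_at_time[OF t]
  have "(\<lambda>z. ((fst z, t), g z)) \<in>
    measurable (M \<Otimes>\<^sub>M (lborel :: (real ^ 'd) measure)) (predictable_sigma M W T \<Otimes>\<^sub>M borel)"
    by measurable
  from measurable_compose[OF this v] show ?thesis by simp
qed

lemma AE_product_of_AE: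
  assumes "AE \<omega> in M. P \<omega>"
  shows "AE z in M \<Otimes>\<^sub>M (lborel :: (real ^ 'd) measure). P (fst z)"
proof -
  obtain N where N: "{\<omega> \<in> space M. \<not> P \<omega>} \<subseteq> N" "N \<in> null_sets M"
    using assms by (auto elim!: AE_E intro: null_setsI)
  have "N \<times> UNIV \<in> null_sets (M \<Otimes>\<^sub>M (lborel :: (real ^ 'd) measure))"
    using N(2) lborel.emeasure_pair_measure_Times[of N M UNIV]
    by (intro null_setsI) (auto simp: null_setsD1)
  then show ?thesis
    by (rule AE_I') (use N(1) in \<open>auto simp: space_pair_measure\<close>)
qed

text \<open>The set on which \<open>P\<close> fails may be non-measurable, so Fubini's theorem is applied to a measurable null set that covers it.\<close>

lemma AE_iterated:
  fixes P :: "'w \<Rightarrow> real ^ 'd \<Rightarrow> bool"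
  assumes "AE z in M \<Otimes>\<^sub>M lborel. P (fst z) (snd z)"
  shows "AE \<omega> in M. AE x in lborel. P \<omega> x" "AE x in lborel. AE \<omega> in M. P \<omega> x"
proof -
  obtain N where N: "{z \<in> space (M \<Otimes>\<^sub>M lborel). \<not> P (fst z) (snd z)} \<subseteq> N"
      "N \<in> null_sets (M \<Otimes>\<^sub>M lborel)"
    using assms by (auto elim!: AE_E intro: null_setsI)
  have [measurable]: "N \<in> sets (M \<Otimes>\<^sub>M lborel)" using N by auto
  have "AE z in M \<Otimes>\<^sub>M lborel. (fst z, snd z) \<notin> N" using AE_not_in[OF N(2)] by simp
  then have 1: "AE \<omega> in M. AE x in lborel. (\<omega>, x) \<notin> N" using product.AE_pair by force
  have 2: "AE x in lborel. AE \<omega> in M. (\<omega>, x) \<notin> N"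
  proof -
    have "{z \<in> space (M \<Otimes>\<^sub>M lborel). (fst z, snd z) \<notin> N} = space (M \<Otimes>\<^sub>M lborel) - N" by auto
    also have "\<dots> \<in> sets (M \<Otimes>\<^sub>M lborel)" by (rule sets.compl_sets) fact
    finally show ?thesis using 1 product.AE_commute[of "\<lambda>\<omega> x. (\<omega>, x) \<notin> N"] by blast
  qed
  have *: "P \<omega> x" if "\<omega> \<in> space M" "(\<omega>, x) \<notin> N" for \<omega> x
    using subsetD[OF N(1), of "(\<omega>, x)"] that by (auto simp: space_pair_measure)
  show "AE \<omega> in M. AE x in lborel. P \<omega> x"
    using 1 AE_space by eventually_elim (auto elim!: eventually_mono intro: *)
  show "AE x in lborel. AE \<omega> in M. P \<omega> x"
    using 2
  proof eventually_elim
    case (elim x)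
    with AE_space show ?case by eventually_elim (rule *)
  qed
qed

text \<open>The suprema over paths are measurable only after modification on a null set. That suffices for both iterated
integrals to agree, and allows passing from the order of integration in the hypothesis on \<open>u\<close> to
that in the definition of a regular potential.\<close>

lemma iterated_nn_integrals:
  assumes S [measurable]: "S \<in> borel_measurable (M \<Otimes>\<^sub>M lborel)"
    and eq: "AE z in M \<Otimes>\<^sub>M lborel. f (fst z) (snd z) = S z"
  shows "(\<integral>\<^sup>+\<omega>. (\<integral>\<^sup>+(x :: real ^ 'd). f \<omega> x \<partial>lborel) \<partial>M) = (\<integral>\<^sup>+z. S z \<partial>(M \<Otimes>\<^sub>M lborel))"
    and "(\<integral>\<^sup>+(x :: real ^ 'd). (\<integral>\<^sup>+\<omega>. f \<omega> x \<partial>M) \<partial>lborel) = (\<integral>\<^sup>+z. S z \<partial>(M \<Otimes>\<^sub>M lborel))"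
proof -
  have eq': "AE z in M \<Otimes>\<^sub>M lborel. f (fst z) (snd z) = S (fst z, snd z)" using eq by simp
  note it = AE_iterated[of "\<lambda>\<omega> x. f \<omega> x = S (\<omega>, x)", OF eq'] 
  have "(\<integral>\<^sup>+\<omega>. (\<integral>\<^sup>+x. f \<omega> x \<partial>lborel) \<partial>M) = (\<integral>\<^sup>+\<omega>. (\<integral>\<^sup>+x. S (\<omega>, x) \<partial>lborel) \<partial>M)"
    by (rule nn_integral_cong_AE) (use it(1) in \<open>auto elim!: eventually_mono intro: nn_integral_cong_AE\<close>)
  also have "\<dots> = (\<integral>\<^sup>+z. S z \<partial>(M \<Otimes>\<^sub>M lborel))" by (rule lborel.nn_integral_fst) simp
  finally show "(\<integral>\<^sup>+\<omega>. (\<integral>\<^sup>+x. f \<omega> x \<partial>lborel) \<partial>M) = (\<integral>\<^sup>+z. S z \<partial>(M \<Otimes>\<^sub>M lborel))" .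
  have "(\<integral>\<^sup>+x. (\<integral>\<^sup>+\<omega>. f \<omega> x \<partial>M) \<partial>lborel) = (\<integral>\<^sup>+x. (\<integral>\<^sup>+\<omega>. S (\<omega>, x) \<partial>M) \<partial>lborel)"
    by (rule nn_integral_cong_AE) (use it(2) in \<open>auto elim!: eventually_mono intro: nn_integral_cong_AE\<close>)
  also have "\<dots> = (\<integral>\<^sup>+z. S z \<partial>(M \<Otimes>\<^sub>M lborel))" by (rule product.nn_integral_snd) simp
  finally show "(\<integral>\<^sup>+x. (\<integral>\<^sup>+\<omega>. f \<omega> x \<partial>M) \<partial>lborel) = (\<integral>\<^sup>+z. S z \<partial>(M \<Otimes>\<^sub>M lborel))" .
qed

text \<open>\<open>h\<close> stands for the given random function along the paths and \<open>g\<close> for its predictable version: the paths of \<open>h\<close> are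
continuous, the sections of \<open>g\<close> are measurable.\<close>

lemma measurable_path_supremum:
  fixes g h :: "real \<Rightarrow> 'w \<times> (real ^ 'd) \<Rightarrow> ennreal"
  assumes g: "\<And>t. t \<in> {0..T} \<Longrightarrow> g t \<in> borel_measurable (M \<Otimes>\<^sub>M lborel)"
    and eq: "AE z in M \<Otimes>\<^sub>M lborel. \<forall>t\<in>{0..T}. h t z = g t z"
    and cont: "AE z in M \<Otimes>\<^sub>M lborel. continuous_on {0..T} (\<lambda>t. h t z)"
  obtains S where "S \<in> borel_measurable (M \<Otimes>\<^sub>M lborel)"
    and "AE z in M \<Otimes>\<^sub>M lborel. (SUP t\<in>{0..T}. h t z) = S z"
proof -
  obtain Q where Q: "countable Q" "Q \<subseteq> {0..T}" "{0..T} \<subseteq> closure Q" using separable by blast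
  show thesis
  proof
    show "(\<lambda>z. SUP t\<in>Q. g t z) \<in> borel_measurable (M \<Otimes>\<^sub>M lborel)"
      using Q g by (intro borel_measurable_SUP) auto
    show "AE z in M \<Otimes>\<^sub>M lborel. (SUP t\<in>{0..T}. h t z) = (SUP t\<in>Q. g t z)"
      using eq cont
    proof eventually_elim
      case (elim z)
      have "(SUP t\<in>{0..T}. h t z) = (SUP t\<in>Q. h t z)" by (rule SUP_dense_eq[OF Q(2,3) elim(2)])
      also have "\<dots> = (SUP t\<in>Q. g t z)" using elim(1) Q(2) by (intro SUP_cong) auto
      finally show ?case .
    qed
  qed
qed

lemma path_supremum_measurable:
  assumes w: "predictable_version M W T w"
    and cont: "AE z in M \<Otimes>\<^sub>M lborel. continuous_on {0..T} (\<lambda>t. w (fst z) t (snd z + X t (fst z)))"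
  obtains S where "S \<in> borel_measurable (M \<Otimes>\<^sub>M lborel)"
    and "AE z in M \<Otimes>\<^sub>M lborel. (SUP t\<in>{0..T}. abs_square (w (fst z) t (snd z + X t (fst z)))) = S z"
proof -
  obtain p where p: "(\<lambda>((\<omega>, t), x). p \<omega> t x) \<in> borel_measurable (predictable_sigma M W T \<Otimes>\<^sub>M borel)"
    and eq: "AE \<omega> in M. \<forall>t\<in>{0..T}. \<forall>x. w \<omega> t x = p \<omega> t x"
    using w unfolding predictable_version_def by blast
  show thesis
  proof (rule measurable_path_supremum[of "\<lambda>t z. abs_square (p (fst z) t (snd z + X t (fst z)))"
        "\<lambda>t z. abs_square (w (fst z) t (snd z + X t (fst z)))"])
    fix t assume t: "t \<in> {0..T}"
    have [measurable]: "(\<lambda>z. snd z + X t (fst z)) \<in> borel_measurable (M \<Otimes>\<^sub>M lborel)"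
      using X_measurable[OF t] by measurable
    have [measurable]: "(\<lambda>z. p (fst z) t (snd z + X t (fst z))) \<in> borel_measurable (M \<Otimes>\<^sub>M lborel)"
      by (rule measurable_evaluation[OF p t]) measurable
    show "(\<lambda>z. abs_square (p (fst z) t (snd z + X t (fst z)))) \<in> borel_measurable (M \<Otimes>\<^sub>M lborel)"
      by measurable
  next
    show "AE z in M \<Otimes>\<^sub>M lborel. \<forall>t\<in>{0..T}. abs_square (w (fst z) t (snd z + X t (fst z))) =
        abs_square (p (fst z) t (snd z + X t (fst z)))"
      using AE_product_of_AE[OF eq] by eventually_elim simp
    show "AE z in M \<Otimes>\<^sub>M lborel. continuous_on {0..T} (\<lambda>t. abs_square (w (fst z) t (snd z + X t (fst z))))"
      using cont by eventually_elim (auto simp: continuous_on_def intro: tendsto_abs_square)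
  qed (rule that)
qed

text \<open>Choose exceptional sets \<open>D k\<close> that are hit with measure at most \<open>1/(k+1)\<close>. Almost every path misses one of them,
and off that set the function is continuous.\<close>

lemma quasi_continuous_paths:
  assumes "quasi_continuous M W T X u"
  shows "AE z in M \<Otimes>\<^sub>M lborel. continuous_on {0..T} (\<lambda>t. u (fst z) t (snd z + X t (fst z)))"
proof -
  define H where "H D = {(\<omega>, x). \<omega> \<in> space M \<and> (\<exists>t\<in>{0..T}. ((\<omega>, t), x + X t \<omega>) \<in> D)}" for D
  define R where "R k D B \<longleftrightarrow> B \<in> sets (M \<Otimes>\<^sub>M lborel) \<and> H D \<subseteq> B \<and> emeasure (M \<Otimes>\<^sub>M lborel) B \<le> ennreal (1 / Suc k)
      \<and> (AE \<omega> in M. continuous_on ({0..T} \<times> UNIV - {(t, x). ((\<omega>, t), x) \<in> D}) (\<lambda>(t, x). u \<omega> t x))"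
    for k :: nat and D B
  have "\<exists>D B. R k D B" for k
  proof -
    have "0 < 1 / real (Suc k)" by simp
    with assms obtain D where D: "AE \<omega> in M. openin (top_of_set ({0..T} \<times> UNIV)) {(t, x). ((\<omega>, t), x) \<in> D} \<and>
        continuous_on ({0..T} \<times> UNIV - {(t, x). ((\<omega>, t), x) \<in> D}) (\<lambda>(t, x). u \<omega> t x)"
      "outer_measure_of (M \<Otimes>\<^sub>M lborel) (H D) \<le> ennreal (1 / Suc k)"
      and Dm: "D \<in> sets (predictable_sigma M W T \<Otimes>\<^sub>M borel)"
      unfolding quasi_continuous_def H_def by blast
    have "H D \<subseteq> space (M \<Otimes>\<^sub>M lborel)" by (auto simp: H_def space_pair_measure)
    from outer_measure_of_attain[OF this] D show ?thesis
      unfolding R_def by (intro exI[of _ D]) (auto elim!: eventually_mono)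
  qed
  then obtain D B where "R k (D k) (B k)" for k by metis
  then have B: "\<And>k. B k \<in> sets (M \<Otimes>\<^sub>M lborel)" "\<And>k. H (D k) \<subseteq> B k"
      "\<And>k. emeasure (M \<Otimes>\<^sub>M lborel) (B k) \<le> ennreal (1 / Suc k)"
    and C: "\<And>k. AE \<omega> in M. continuous_on ({0..T} \<times> UNIV - {(t, x). ((\<omega>, t), x) \<in> D k}) (\<lambda>(t, x). u \<omega> t x)"
    unfolding R_def by auto
  have "(\<lambda>k. ennreal (1 / Suc k)) \<longlonglongrightarrow> ennreal 0"
    by (intro tendsto_ennrealI lim_const_over_n[THEN LIMSEQ_Suc])
  moreover have "emeasure (M \<Otimes>\<^sub>M lborel) (\<Inter>k. B k) \<le> ennreal (1 / Suc k)" for k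
    by (rule order_trans[OF emeasure_mono B(3)]) (use B(1) in auto)
  ultimately have "emeasure (M \<Otimes>\<^sub>M lborel) (\<Inter>k. B k) \<le> ennreal 0"
    by (intro LIMSEQ_le_const) auto
  then have "(\<Inter>k. B k) \<in> null_sets (M \<Otimes>\<^sub>M lborel)" using B(1) by (intro null_setsI) auto
  then have "AE z in M \<Otimes>\<^sub>M lborel. z \<notin> (\<Inter>k. B k)" by (rule AE_not_in)
  moreover have "AE z in M \<Otimes>\<^sub>M (lborel :: (real ^ 'd) measure). \<forall>k.
      continuous_on ({0..T} \<times> UNIV - {(t, x). ((fst z, t), x) \<in> D k}) (\<lambda>(t, x). u (fst z) t x)"
    using C by (intro AE_product_of_AE) (simp add: AE_all_countable)
  moreover have "AE z in M \<Otimes>\<^sub>M (lborel :: (real ^ 'd) measure). continuous_on {0..T} (\<lambda>t. X t (fst z))"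
    by (rule AE_product_of_AE[OF X_continuous])
  ultimately show ?thesis using AE_space
  proof eventually_elim
    case (elim z)
    then obtain k where "z \<notin> B k" by blast
    then have "z \<notin> H (D k)" using B(2) by blast
    then have miss: "((fst z, t), snd z + X t (fst z)) \<notin> D k" if "t \<in> {0..T}" for t
      using that elim(4) by (auto simp: H_def space_pair_measure)
    have "continuous_on {0..T} (\<lambda>t. (t, snd z + X t (fst z)))"
      using elim(3) by (intro continuous_intros)
    moreover have "(\<lambda>t. (t, snd z + X t (fst z))) ` {0..T} \<subseteq>
        {0..T} \<times> UNIV - {(t, x). ((fst z, t), x) \<in> D k}"
      using miss by blast
    ultimately have "continuous_on {0..T}
        (\<lambda>t. (\<lambda>(t, x). u (fst z) t x) (t, snd z + X t (fst z)))"
      by (rule continuous_on_compose2[OF elim(2)[rule_format, of k]])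
    then show ?case by simp
  qed
qed

text \<open>By translation invariance, the square of the shifted value integrates over \<open>\<Omega> \<times> \<real>\<^sup>d\<close> to the expectation of
\<open>\<parallel>w(r)\<parallel>\<^sup>2\<close>, whatever the shift. By Fubini's theorem it is a square integrable random variable for almost
every \<open>x\<close>.\<close>

lemma shifted_value_integrable:
  fixes w :: "'w \<Rightarrow> real \<Rightarrow> real ^ 'd \<Rightarrow> ereal"
  assumes w: "in_S2_L2 M W T w" and t: "t \<in> {0..T}" and r: "r \<in> {0..T}"
  shows "AE x in lborel. integrable M (\<lambda>\<omega>. real_of_ereal (w \<omega> r (x + X r \<omega> - X t \<omega>))) \<and>
    (AE \<omega> in M. \<bar>w \<omega> r (x + X r \<omega> - X t \<omega>)\<bar> \<noteq> \<infinity>)"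
proof -
  obtain p where p: "(\<lambda>((\<omega>, t), x). p \<omega> t x) \<in> borel_measurable (predictable_sigma M W T \<Otimes>\<^sub>M borel)"
    and eq: "AE \<omega> in M. \<forall>t\<in>{0..T}. \<forall>x. w \<omega> t x = p \<omega> t x"
    using w unfolding in_S2_L2_def predictable_version_def by blast
  define K where "K z = p (fst z) r (snd z + X r (fst z) - X t (fst z))" for z
  have [measurable]: "(\<lambda>z. snd z + X r (fst z) - X t (fst z)) \<in> borel_measurable (M \<Otimes>\<^sub>M lborel)"
    using X_measurable[OF t] X_measurable[OF r] by measurable
  have [measurable]: "K \<in> borel_measurable (M \<Otimes>\<^sub>M lborel)"
    unfolding K_def by (rule measurable_evaluation[OF p r]) measurable
  have l2: "AE \<omega> in M. (\<integral>\<^sup>+x. abs_square (K (\<omega>, x)) \<partial>lborel) = l2_norm_square (w \<omega> r)"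
  proof -
    have "AE \<omega> in M. w \<omega> r \<in> borel_measurable borel"
      using w r unfolding in_S2_L2_def by (auto elim: eventually_mono)
    with eq show ?thesis
    proof eventually_elim
      case (elim \<omega>)
      then have "K (\<omega>, x) = w \<omega> r (x + (X r \<omega> - X t \<omega>))" for x
        using r by (simp add: K_def algebra_simps)
      then show ?case using l2_norm_square_translate[OF elim(2)] by simp
    qed
  qed
  have "(\<integral>\<^sup>+x. \<integral>\<^sup>+\<omega>. abs_square (K (\<omega>, x)) \<partial>M \<partial>lborel) = (\<integral>\<^sup>+z. abs_square (K z) \<partial>(M \<Otimes>\<^sub>M lborel))"
    by (rule product.nn_integral_snd) measurable
  also have "\<dots> = (\<integral>\<^sup>+\<omega>. \<integral>\<^sup>+x. abs_square (K (\<omega>, x)) \<partial>lborel \<partial>M)"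
    by (rule lborel.nn_integral_fst[symmetric]) measurable
  also have "\<dots> = (\<integral>\<^sup>+\<omega>. l2_norm_square (w \<omega> r) \<partial>M)"
    by (rule nn_integral_cong_AE[OF l2])
  also have "\<dots> \<le> (\<integral>\<^sup>+\<omega>. (SUP t\<in>{0..T}. l2_norm_square (w \<omega> t)) \<partial>M)"
    using r by (intro nn_integral_mono SUP_upper)
  also have "\<dots> < \<infinity>" using w by (simp add: in_S2_L2_def)
  finally have "AE x in lborel. (\<integral>\<^sup>+\<omega>. abs_square (K (\<omega>, x)) \<partial>M) \<noteq> \<infinity>"
    by (intro nn_integral_PInf_AE) auto
  then show ?thesis
  proof eventually_elim
    case (elim x)
    have [measurable]: "(\<lambda>\<omega>. K (\<omega>, x)) \<in> borel_measurable M" by measurable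
    have eqx: "AE \<omega> in M. w \<omega> r (x + X r \<omega> - X t \<omega>) = K (\<omega>, x)"
      using eq by eventually_elim (use r in \<open>simp add: K_def\<close>)
    have "AE \<omega> in M. abs_square (K (\<omega>, x)) \<noteq> \<infinity>"
      using elim by (intro nn_integral_PInf_AE) auto
    then have fin: "AE \<omega> in M. \<bar>w \<omega> r (x + X r \<omega> - X t \<omega>)\<bar> \<noteq> \<infinity>"
      using eqx by eventually_elim (metis abs_square_top_iff)
    have "integrable M (\<lambda>\<omega>. real_of_ereal (w \<omega> r (x + X r \<omega> - X t \<omega>)))"
    proof (rule integrableI_bounded)
      show "(\<lambda>\<omega>. real_of_ereal (w \<omega> r (x + X r \<omega> - X t \<omega>))) \<in> borel_measurable M"
        by (rule measurable_cong_AE_complete[of "\<lambda>\<omega>. real_of_ereal (K (\<omega>, x))"])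
          (use eqx in \<open>auto elim!: eventually_mono\<close>)
      have "(\<integral>\<^sup>+\<omega>. ennreal (norm (real_of_ereal (w \<omega> r (x + X r \<omega> - X t \<omega>)))) \<partial>M)
          \<le> (\<integral>\<^sup>+\<omega>. 1 + abs_square (K (\<omega>, x)) \<partial>M)"
      proof (rule nn_integral_mono_AE)
        show "AE \<omega> in M. ennreal (norm (real_of_ereal (w \<omega> r (x + X r \<omega> - X t \<omega>)))) \<le> 1 + abs_square (K (\<omega>, x))"
          using eqx fin
        proof eventually_elim
          case (elim \<omega>)
          then obtain a where a: "w \<omega> r (x + X r \<omega> - X t \<omega>) = ereal a" "K (\<omega>, x) = ereal a" by auto
          \<comment> \<open>square integrability implies integrability on a probability space\<close>
          have "0 \<le> (\<bar>a\<bar> - 1)\<^sup>2 + \<bar>a\<bar>" by simp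
          then have "\<bar>a\<bar> \<le> 1 + a\<^sup>2" by (simp add: power2_eq_square algebra_simps)
          then have "ennreal \<bar>a\<bar> \<le> ennreal (1 + a\<^sup>2)" by (rule ennreal_leI)
          then show ?case by (simp add: a)
        qed
      qed
      also have "\<dots> = 1 + (\<integral>\<^sup>+\<omega>. abs_square (K (\<omega>, x)) \<partial>M)"
        by (subst nn_integral_add) (auto simp: emeasure_space_1)
      also have "\<dots> < \<infinity>" using elim by (simp add: top.not_eq_extremum)
      finally show "(\<integral>\<^sup>+\<omega>. ennreal (norm (real_of_ereal (w \<omega> r (x + X r \<omega> - X t \<omega>)))) \<partial>M) < \<infinity>" .
    qed
    with fin show ?case by blast
  qed
qed

end

section \<open>Increasing limits of regular potentials\<close>

text \<open>The sequence is indexed from 0 here, so that the smallest potential is \<open>v 0\<close>.\<close>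

locale increasing_potentials = random_translation M W T X
  for M :: "'w measure" and W :: "real \<Rightarrow> 'w \<Rightarrow> real ^ 'm" and T :: real
    and X :: "real \<Rightarrow> 'w \<Rightarrow> real ^ 'd" +
  fixes v :: "nat \<Rightarrow> 'w \<Rightarrow> real \<Rightarrow> real ^ 'd \<Rightarrow> ereal"
    and u :: "'w \<Rightarrow> real \<Rightarrow> real ^ 'd \<Rightarrow> ereal"
  assumes potentials: "\<And>n. regular_potential M W T X (v n)"
    and increasing_limit: "AE \<omega> in M. \<forall>t\<in>{0..T}. \<forall>x.
      (\<forall>n. v n \<omega> t x \<le> v (Suc n) \<omega> t x) \<and> (\<lambda>n. v n \<omega> t x) \<longlonglongrightarrow> u \<omega> t x"
    and u_path_continuous: "AE z in M \<Otimes>\<^sub>M lborel.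
      continuous_on {0..T} (\<lambda>t. u (fst z) t (snd z + X t (fst z)))"
    and u_path_square_integrable:
      "(\<integral>\<^sup>+x. (\<integral>\<^sup>+\<omega>. (SUP t\<in>{0..T}. abs_square (u \<omega> t (x + X t \<omega>))) \<partial>M) \<partial>lborel) < \<infinity>"
begin

lemma v_mono_le_u:
  "AE \<omega> in M. \<forall>t\<in>{0..T}. \<forall>x.
     (\<forall>m n. m \<le> n \<longrightarrow> v m \<omega> t x \<le> v n \<omega> t x) \<and> (\<forall>n. v n \<omega> t x \<le> u \<omega> t x) \<and>
     (\<lambda>n. v n \<omega> t x) \<longlonglongrightarrow> u \<omega> t x \<and> u \<omega> t x = (SUP n. v n \<omega> t x)"
  using increasing_limit
proof eventually_elim
  case (elim \<omega>)
  show ?case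
  proof (intro ballI allI conjI impI)
    fix t x and m n :: nat assume t: "t \<in> {0..T}"
    from elim t have inc: "incseq (\<lambda>n. v n \<omega> t x)" and lim: "(\<lambda>n. v n \<omega> t x) \<longlonglongrightarrow> u \<omega> t x"
      by (auto simp: incseq_Suc_iff)
    show "v m \<omega> t x \<le> v n \<omega> t x" if "m \<le> n" using incseqD[OF inc that] .
    show "v n \<omega> t x \<le> u \<omega> t x" using incseq_le[OF inc lim] .
    show "(\<lambda>n. v n \<omega> t x) \<longlonglongrightarrow> u \<omega> t x" by fact
    show "u \<omega> t x = (SUP n. v n \<omega> t x)" by (rule LIMSEQ_unique[OF lim LIMSEQ_SUP[OF inc]])
  qed
qed

lemma v_predictable: "predictable_version M W T (v n)"
  using potentials[of n] by (auto simp: regular_potential_def in_S2_L2_def)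

lemma u_predictable: "predictable_version M W T u"
proof -
  define R where "R n w \<longleftrightarrow> (\<lambda>((\<omega>, t), x). w \<omega> t x) \<in> borel_measurable (predictable_sigma M W T \<Otimes>\<^sub>M borel) \<and>
      (AE \<omega> in M. \<forall>t\<in>{0..T}. \<forall>x. v n \<omega> t x = w \<omega> t x)" for n w
  have "\<forall>n. \<exists>w. R n w" using v_predictable by (simp add: predictable_version_def R_def)
  then obtain w where "\<forall>n. R n (w n)" by (rule choice[THEN exE])
  then have w: "(\<lambda>((\<omega>, t), x). w n \<omega> t x) \<in> borel_measurable (predictable_sigma M W T \<Otimes>\<^sub>M borel)"
    and eq: "AE \<omega> in M. \<forall>t\<in>{0..T}. \<forall>x. v n \<omega> t x = w n \<omega> t x" for n
    by (simp_all add: R_def)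
  have "AE \<omega> in M. \<forall>n. \<forall>t\<in>{0..T}. \<forall>x. v n \<omega> t x = w n \<omega> t x"
    unfolding AE_all_countable by (intro allI eq)
  then have "AE \<omega> in M. \<forall>t\<in>{0..T}. \<forall>x. u \<omega> t x = (SUP n. w n \<omega> t x)"
    using v_mono_le_u by eventually_elim simp
  moreover have "(\<lambda>((\<omega>, t), x). SUP n. w n \<omega> t x) \<in> borel_measurable (predictable_sigma M W T \<Otimes>\<^sub>M borel)"
  proof -
    have "(\<lambda>z. SUP n. (\<lambda>((\<omega>, t), x). w n \<omega> t x) z) \<in> borel_measurable (predictable_sigma M W T \<Otimes>\<^sub>M borel)"
      by (rule borel_measurable_SUP) (use w in auto)
    then show ?thesis by (simp add: case_prod_beta')
  qed
  ultimately show ?thesis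
    unfolding predictable_version_def by (intro exI[of _ "\<lambda>\<omega> t x. SUP n. w n \<omega> t x"] conjI)
qed

lemma v_path_continuous:
  "AE z in M \<Otimes>\<^sub>M lborel. continuous_on {0..T} (\<lambda>t. v n (fst z) t (snd z + X t (fst z)))"
  using potentials[of n] by (intro quasi_continuous_paths) (simp add: regular_potential_def)

text \<open>One integrable function \<open>B\<close> dominates the squares of \<open>u\<close> and of \<open>v 0\<close> along the paths, and with them those of every
\<open>v n\<close>, which lies in between.\<close>

lemma path_domination:
  obtains B where "B \<in> borel_measurable (M \<Otimes>\<^sub>M lborel)"
    and "(\<integral>\<^sup>+z. B z \<partial>(M \<Otimes>\<^sub>M lborel)) < \<infinity>"
    and "AE z in M \<Otimes>\<^sub>M lborel. B z < \<infinity> \<and> (\<forall>t\<in>{0..T}.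
      abs_square (u (fst z) t (snd z + X t (fst z))) \<le> B z \<and>
      abs_square (v 0 (fst z) t (snd z + X t (fst z))) \<le> B z)"
    and "(\<integral>\<^sup>+\<omega>. (\<integral>\<^sup>+x. (SUP t\<in>{0..T}. abs_square (u \<omega> t (x + X t \<omega>))) \<partial>lborel) \<partial>M) < \<infinity>"
proof -
  obtain S where S [measurable]: "S \<in> borel_measurable (M \<Otimes>\<^sub>M lborel)" and eqS:
    "AE z in M \<Otimes>\<^sub>M lborel. (SUP t\<in>{0..T}. abs_square (u (fst z) t (snd z + X t (fst z)))) = S z"
    using path_supremum_measurable[OF u_predictable u_path_continuous] .
  obtain R where R [measurable]: "R \<in> borel_measurable (M \<Otimes>\<^sub>M lborel)" and eqR:
    "AE z in M \<Otimes>\<^sub>M lborel. (SUP t\<in>{0..T}. abs_square (v 0 (fst z) t (snd z + X t (fst z)))) = R z"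
    using path_supremum_measurable[OF v_predictable v_path_continuous] .
  have intS: "(\<integral>\<^sup>+z. S z \<partial>(M \<Otimes>\<^sub>M lborel)) < \<infinity>"
    using u_path_square_integrable
    by (subst (asm) iterated_nn_integrals(2)[OF S, of "\<lambda>\<omega> x. SUP t\<in>{0..T}. abs_square (u \<omega> t (x + X t \<omega>))"])
      (use eqS in auto)
  have "(\<integral>\<^sup>+\<omega>. (\<integral>\<^sup>+x. (SUP t\<in>{0..T}. abs_square (v 0 \<omega> t (x + X t \<omega>))) \<partial>lborel) \<partial>M) < \<infinity>"
    using potentials[of 0] by (simp add: regular_potential_def)
  then have intR: "(\<integral>\<^sup>+z. R z \<partial>(M \<Otimes>\<^sub>M lborel)) < \<infinity>"
    by (subst (asm) iterated_nn_integrals(1)[OF R, of "\<lambda>\<omega> x. SUP t\<in>{0..T}. abs_square (v 0 \<omega> t (x + X t \<omega>))"])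
      (use eqR in auto)
  show thesis
  proof (rule that[of "\<lambda>z. S z + R z"])
    show int: "(\<integral>\<^sup>+z. S z + R z \<partial>(M \<Otimes>\<^sub>M lborel)) < \<infinity>"
      using intS intR by (subst nn_integral_add) (auto simp: )
    have "AE z in M \<Otimes>\<^sub>M lborel. S z + R z \<noteq> \<infinity>"
      using int by (intro nn_integral_PInf_AE) auto
    then show "AE z in M \<Otimes>\<^sub>M lborel. S z + R z < \<infinity> \<and> (\<forall>t\<in>{0..T}.
      abs_square (u (fst z) t (snd z + X t (fst z))) \<le> S z + R z \<and>
      abs_square (v 0 (fst z) t (snd z + X t (fst z))) \<le> S z + R z)"
      using eqS eqR
    proof eventually_elim
      case (elim z)
      show ?case
      proof (intro conjI ballI)
        show "S z + R z < \<infinity>" using elim(1) by (simp add: top.not_eq_extremum)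
      next
        fix t assume "t \<in> {0..T}"
        then have "abs_square (u (fst z) t (snd z + X t (fst z))) \<le> S z"
          "abs_square (v 0 (fst z) t (snd z + X t (fst z))) \<le> R z"
          unfolding elim(2,3)[symmetric] by (auto intro: SUP_upper2)
        then show "abs_square (u (fst z) t (snd z + X t (fst z))) \<le> S z + R z"
          "abs_square (v 0 (fst z) t (snd z + X t (fst z))) \<le> S z + R z"
          by (auto intro: add_increasing add_increasing2)
      qed
    qed
    show "(\<integral>\<^sup>+\<omega>. (\<integral>\<^sup>+x. (SUP t\<in>{0..T}. abs_square (u \<omega> t (x + X t \<omega>))) \<partial>lborel) \<partial>M) < \<infinity>"
      using intS
      by (subst iterated_nn_integrals(1)[OF S, of "\<lambda>\<omega> x. SUP t\<in>{0..T}. abs_square (u \<omega> t (x + X t \<omega>))"])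
      (use eqS in auto)
  qed measurable
qed

text \<open>After \<open>real_of_ereal\<close> this is a true squared distance only along paths on which \<open>u\<close> and \<open>v n\<close> are finite; by
\<open>paths_finite\<close> these are almost all.\<close>

definition gap :: "nat \<Rightarrow> 'w \<Rightarrow> real ^ 'd \<Rightarrow> ennreal" where
  "gap n \<omega> x = (SUP t\<in>{0..T}. ennreal ((real_of_ereal (u \<omega> t (x + X t \<omega>)) -
     real_of_ereal (v n \<omega> t (x + X t \<omega>)))\<^sup>2))"

lemma paths_finite:
  "AE z in M \<Otimes>\<^sub>M lborel. \<forall>t\<in>{0..T}. \<bar>u (fst z) t (snd z + X t (fst z))\<bar> \<noteq> \<infinity> \<and>
      (\<forall>n. \<bar>v n (fst z) t (snd z + X t (fst z))\<bar> \<noteq> \<infinity>)"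
proof -
  obtain B where B: "AE z in M \<Otimes>\<^sub>M lborel. B z < \<infinity> \<and> (\<forall>t\<in>{0..T}.
      abs_square (u (fst z) t (snd z + X t (fst z))) \<le> B z \<and>
      abs_square (v 0 (fst z) t (snd z + X t (fst z))) \<le> B z)"
    by (rule path_domination) (rule that; assumption)
  show ?thesis
    using B AE_product_of_AE[OF v_mono_le_u]
  proof eventually_elim
    case (elim z)
    show ?case
    proof (intro ballI conjI allI)
      fix t n assume t: "t \<in> {0..T}"
      note le = square_diff_le(1,2)[of "v 0 (fst z) t (snd z + X t (fst z))"
          "v n (fst z) t (snd z + X t (fst z))" "u (fst z) t (snd z + X t (fst z))" "B z" for n]
      show "\<bar>u (fst z) t (snd z + X t (fst z))\<bar> \<noteq> \<infinity>"
        by (rule le(1)[of 0]) (use elim t in blast)+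
      show "\<bar>v n (fst z) t (snd z + X t (fst z))\<bar> \<noteq> \<infinity>"
        by (rule le(2)) (use elim t in blast)+
    qed
  qed
qed

text \<open>Along almost every path, Dini's theorem applies to the finite continuous functions \<open>v n\<close> and \<open>u\<close>.\<close>

lemma gap_tendsto_0: "AE z in M \<Otimes>\<^sub>M lborel. (\<lambda>n. gap n (fst z) (snd z)) \<longlonglongrightarrow> 0"
proof -
  have "AE z in M \<Otimes>\<^sub>M lborel. \<forall>n. continuous_on {0..T} (\<lambda>t. v n (fst z) t (snd z + X t (fst z)))"
    unfolding AE_all_countable by (intro allI v_path_continuous)
  then show ?thesis
    using paths_finite u_path_continuous AE_product_of_AE[OF v_mono_le_u]
  proof eventually_elim
    case (elim z)
    define f where "f n t = real_of_ereal (v n (fst z) t (snd z + X t (fst z)))" for n t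
    define g where "g t = real_of_ereal (u (fst z) t (snd z + X t (fst z)))" for t
    have fin: "\<bar>u (fst z) t (snd z + X t (fst z))\<bar> \<noteq> \<infinity>" "\<bar>v n (fst z) t (snd z + X t (fst z))\<bar> \<noteq> \<infinity>"
      if "t \<in> {0..T}" for t n using elim(2) that by auto
    have real: "ereal (f n t) = v n (fst z) t (snd z + X t (fst z))"
        "ereal (g t) = u (fst z) t (snd z + X t (fst z))" if "t \<in> {0..T}" for n t
      unfolding f_def g_def using fin[OF that] by (simp_all add: ereal_real')
    have "uniform_limit {0..T} f g sequentially"
    proof (rule Dini_uniform_limit)
      show "continuous_on {0..T} (f n)" for n
        unfolding f_def by (rule continuous_on_real_of_ereal_comp[OF elim(1)[rule_format] fin(2)])
      show "continuous_on {0..T} g"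
        unfolding g_def by (rule continuous_on_real_of_ereal_comp[OF elim(3) fin(1)])
      show "f n t \<le> f (Suc n) t" if t: "t \<in> {0..T}" for n t
      proof -
        have "v n (fst z) t (snd z + X t (fst z)) \<le> v (Suc n) (fst z) t (snd z + X t (fst z))"
          using elim(4) t by (meson le_SucI order_refl)
        then show ?thesis using real(1)[OF t] by (metis ereal_less_eq(3))
      qed
      show "(\<lambda>n. f n t) \<longlonglongrightarrow> g t" if t: "t \<in> {0..T}" for t
      proof -
        have "(\<lambda>n. v n (fst z) t (snd z + X t (fst z))) \<longlonglongrightarrow> u (fst z) t (snd z + X t (fst z))"
          using elim(4) t by blast
        then show ?thesis unfolding real[OF t, symmetric] by simp
      qed
    qed simp
    then have unif: "\<forall>\<^sub>F n in sequentially. \<forall>t\<in>{0..T}. dist (f n t) (g t) < e" if "0 < e" for e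
      using that by (rule uniform_limitD)
    show "(\<lambda>n. gap n (fst z) (snd z)) \<longlonglongrightarrow> 0"
    proof (rule tendsto_zero_ennreal)
      fix r :: real assume r: "0 < r"
      show "\<forall>\<^sub>F n in sequentially. gap n (fst z) (snd z) < ennreal r"
      proof (rule eventually_mono[OF unif[of "sqrt (r / 2)"]])
        show "0 < sqrt (r / 2)" using r by simp
        fix n assume n: "\<forall>t\<in>{0..T}. dist (f n t) (g t) < sqrt (r / 2)"
        have "gap n (fst z) (snd z) \<le> ennreal (r / 2)"
          unfolding gap_def
        proof (rule SUP_least)
          fix t assume t: "t \<in> {0..T}"
          then have "\<bar>g t - f n t\<bar> < sqrt (r / 2)" using n by (auto simp: dist_real_def abs_minus_commute)
          then have "\<bar>g t - f n t\<bar>\<^sup>2 \<le> (sqrt (r / 2))\<^sup>2" by (intro power_mono) auto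
          then have "(g t - f n t)\<^sup>2 \<le> r / 2" using r by simp
          then show "ennreal ((real_of_ereal (u (fst z) t (snd z + X t (fst z))) -
             real_of_ereal (v n (fst z) t (snd z + X t (fst z))))\<^sup>2) \<le> ennreal (r / 2)"
            unfolding f_def g_def by (rule ennreal_leI)
        qed
        also have "\<dots> < ennreal r" using r by (simp add: ennreal_less_iff)
        finally show "gap n (fst z) (snd z) < ennreal r" .
      qed
    qed
  qed
qed

text \<open>\<open>G\<close> is a jointly measurable version of the gap, obtained from suprema over countably many times; \<open>B\<close> allows
dominated convergence both on \<open>\<Omega> \<times> \<real>\<^sup>d\<close> and on \<open>\<real>\<^sup>d\<close> for fixed \<open>\<omega>\<close>.\<close>

lemma gap_dominated:
  obtains G B where "\<forall>n. G n \<in> borel_measurable (M \<Otimes>\<^sub>M lborel)" "B \<in> borel_measurable (M \<Otimes>\<^sub>M lborel)"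
    and "(\<integral>\<^sup>+z. B z \<partial>(M \<Otimes>\<^sub>M lborel)) < \<infinity>"
    and "AE z in M \<Otimes>\<^sub>M lborel. \<forall>n. gap n (fst z) (snd z) = G n z \<and> G n z \<le> B z"
    and "AE z in M \<Otimes>\<^sub>M lborel. (\<lambda>n. G n z) \<longlonglongrightarrow> 0"
proof -
  obtain B where [measurable]: "B \<in> borel_measurable (M \<Otimes>\<^sub>M lborel)"
    and intB: "(\<integral>\<^sup>+z. B z \<partial>(M \<Otimes>\<^sub>M lborel)) < \<infinity>"
    and B: "AE z in M \<Otimes>\<^sub>M lborel. B z < \<infinity> \<and> (\<forall>t\<in>{0..T}.
      abs_square (u (fst z) t (snd z + X t (fst z))) \<le> B z \<and>
      abs_square (v 0 (fst z) t (snd z + X t (fst z))) \<le> B z)"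
    by (rule path_domination) (rule that; assumption)
  have le: "AE z in M \<Otimes>\<^sub>M lborel. \<forall>n. gap n (fst z) (snd z) \<le> 4 * B z"
    using B AE_product_of_AE[OF v_mono_le_u]
  proof eventually_elim
    case (elim z)
    show ?case
      unfolding gap_def
    proof (intro allI SUP_least)
      fix n t assume t: "t \<in> {0..T}"
      then show "ennreal ((real_of_ereal (u (fst z) t (snd z + X t (fst z))) -
             real_of_ereal (v n (fst z) t (snd z + X t (fst z))))\<^sup>2) \<le> 4 * B z"
        using elim by (intro square_diff_le(3)[of "v 0 (fst z) t (snd z + X t (fst z))"]) blast+
    qed
  qed
  have "\<exists>G. G \<in> borel_measurable (M \<Otimes>\<^sub>M lborel) \<and> (AE z in M \<Otimes>\<^sub>M lborel. gap n (fst z) (snd z) = G z)" for n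
  proof -
    obtain p where p: "(\<lambda>((\<omega>, t), x). p \<omega> t x) \<in> borel_measurable (predictable_sigma M W T \<Otimes>\<^sub>M borel)"
      and eqp: "AE \<omega> in M. \<forall>t\<in>{0..T}. \<forall>x. u \<omega> t x = p \<omega> t x"
      using u_predictable unfolding predictable_version_def by blast
    obtain q where q: "(\<lambda>((\<omega>, t), x). q \<omega> t x) \<in> borel_measurable (predictable_sigma M W T \<Otimes>\<^sub>M borel)"
      and eqq: "AE \<omega> in M. \<forall>t\<in>{0..T}. \<forall>x. v n \<omega> t x = q \<omega> t x"
      using v_predictable[of n] unfolding predictable_version_def by blast
    define h where "h t z = ennreal ((real_of_ereal (u (fst z) t (snd z + X t (fst z))) -
             real_of_ereal (v n (fst z) t (snd z + X t (fst z))))\<^sup>2)" for t z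
    define g where "g t z = ennreal ((real_of_ereal (p (fst z) t (snd z + X t (fst z))) -
             real_of_ereal (q (fst z) t (snd z + X t (fst z))))\<^sup>2)" for t z
    obtain S where S: "S \<in> borel_measurable (M \<Otimes>\<^sub>M lborel)"
      "AE z in M \<Otimes>\<^sub>M lborel. (SUP t\<in>{0..T}. h t z) = S z"
    proof (rule measurable_path_supremum[of g h])
      fix t assume t: "t \<in> {0..T}"
      have [measurable]: "(\<lambda>z. snd z + X t (fst z)) \<in> borel_measurable (M \<Otimes>\<^sub>M lborel)"
        using X_measurable[OF t] by measurable
      have [measurable]: "(\<lambda>z. p (fst z) t (snd z + X t (fst z))) \<in> borel_measurable (M \<Otimes>\<^sub>M lborel)"
        by (rule measurable_evaluation[OF p t]) measurable
      have [measurable]: "(\<lambda>z. q (fst z) t (snd z + X t (fst z))) \<in> borel_measurable (M \<Otimes>\<^sub>M lborel)"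
        by (rule measurable_evaluation[OF q t]) measurable
      show "g t \<in> borel_measurable (M \<Otimes>\<^sub>M lborel)"
        unfolding g_def by measurable
    next
      show "AE z in M \<Otimes>\<^sub>M lborel. \<forall>t\<in>{0..T}. h t z = g t z"
        using AE_product_of_AE[OF eqp] AE_product_of_AE[OF eqq] unfolding h_def g_def
        by eventually_elim simp
      show "AE z in M \<Otimes>\<^sub>M lborel. continuous_on {0..T} (\<lambda>t. h t z)"
        using u_path_continuous v_path_continuous[of n] paths_finite
      proof eventually_elim
        case (elim z)
        have "continuous_on {0..T} (\<lambda>t. real_of_ereal (u (fst z) t (snd z + X t (fst z))))"
          by (rule continuous_on_real_of_ereal_comp[OF elim(1)]) (use elim(3) in auto)
        moreover have "continuous_on {0..T} (\<lambda>t. real_of_ereal (v n (fst z) t (snd z + X t (fst z))))"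
          by (rule continuous_on_real_of_ereal_comp[OF elim(2)]) (use elim(3) in auto)
        ultimately show ?case unfolding h_def by (intro continuous_on_ennreal continuous_intros)
      qed
    qed
    have "gap n (fst z) (snd z) = (SUP t\<in>{0..T}. h t z)" for z by (simp add: gap_def h_def)
    with S show ?thesis by auto
  qed
  from choice[OF allI[OF this]]
  obtain G where "\<forall>n. G n \<in> borel_measurable (M \<Otimes>\<^sub>M lborel) \<and>
      (AE z in M \<Otimes>\<^sub>M lborel. gap n (fst z) (snd z) = G n z)" by (rule exE)
  then have G [measurable]: "\<And>n. G n \<in> borel_measurable (M \<Otimes>\<^sub>M lborel)"
    and eq: "\<And>n. AE z in M \<Otimes>\<^sub>M lborel. gap n (fst z) (snd z) = G n z" by simp_all
  have eq': "AE z in M \<Otimes>\<^sub>M lborel. \<forall>n. gap n (fst z) (snd z) = G n z"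
    unfolding AE_all_countable by (intro allI eq)
  show thesis
  proof (rule that[of G "\<lambda>z. 4 * B z"])
    show "(\<integral>\<^sup>+z. 4 * B z \<partial>(M \<Otimes>\<^sub>M lborel)) < \<infinity>"
      using intB by (simp add: nn_integral_cmult ennreal_mult_less_top)
    show "AE z in M \<Otimes>\<^sub>M lborel. \<forall>n. gap n (fst z) (snd z) = G n z \<and> G n z \<le> 4 * B z"
      using eq' le by eventually_elim auto
    show "AE z in M \<Otimes>\<^sub>M lborel. (\<lambda>n. G n z) \<longlonglongrightarrow> 0"
      using eq' gap_tendsto_0 by eventually_elim simp
  qed (use G in measurable)
qed

text \<open>The gap tends to 0 in measure. As \<open>\<Omega> \<times> \<real>\<^sup>d\<close> has infinite measure, this does not follow from almost everywhere
convergence; it comes from convergence in \<open>L\<^sup>1\<close> and Markov's inequality.\<close>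

lemma gap_exceeds_small:
  assumes "0 < c" "0 < e"
  obtains n N where "N \<in> sets (M \<Otimes>\<^sub>M lborel)" "emeasure (M \<Otimes>\<^sub>M lborel) N \<le> ennreal e"
    and "AE z in M \<Otimes>\<^sub>M lborel. ennreal c \<le> gap n (fst z) (snd z) \<longrightarrow> z \<in> N"
proof -
  obtain G B where "\<forall>n. G n \<in> borel_measurable (M \<Otimes>\<^sub>M lborel)"
    and [measurable]: "B \<in> borel_measurable (M \<Otimes>\<^sub>M lborel)"
    and intB: "(\<integral>\<^sup>+z. B z \<partial>(M \<Otimes>\<^sub>M lborel)) < \<infinity>"
    and G: "AE z in M \<Otimes>\<^sub>M lborel. \<forall>n. gap n (fst z) (snd z) = G n z \<and> G n z \<le> B z"
    and lim: "AE z in M \<Otimes>\<^sub>M lborel. (\<lambda>n. G n z) \<longlonglongrightarrow> 0"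
    by (rule gap_dominated) (rule that; assumption)
  then have [measurable]: "G n \<in> borel_measurable (M \<Otimes>\<^sub>M lborel)" for n by blast
  have "(\<lambda>n. \<integral>\<^sup>+z. G n z \<partial>(M \<Otimes>\<^sub>M lborel)) \<longlonglongrightarrow>
      (\<integral>\<^sup>+z. 0 \<partial>(M \<Otimes>\<^sub>M (lborel :: (real ^ 'd) measure)))"
    by (rule nn_integral_dominated_convergence[where w=B]) (use intB G lim in \<open>auto elim!: eventually_mono\<close>)
  then have "(\<lambda>n. \<integral>\<^sup>+z. G n z \<partial>(M \<Otimes>\<^sub>M lborel)) \<longlonglongrightarrow> 0" by simp
  then have "\<forall>\<^sub>F n in sequentially. (\<integral>\<^sup>+z. G n z \<partial>(M \<Otimes>\<^sub>M lborel)) < ennreal (c * e)"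
    using assms by (intro order_tendstoD) auto
  then obtain n where n: "(\<integral>\<^sup>+z. G n z \<partial>(M \<Otimes>\<^sub>M lborel)) < ennreal (c * e)"
    by (auto simp: eventually_sequentially)
  define N where "N = {z \<in> space (M \<Otimes>\<^sub>M lborel). 1 \<le> ennreal (1 / c) * G n z}"
  show thesis
  proof
    show N: "N \<in> sets (M \<Otimes>\<^sub>M lborel)" unfolding N_def by measurable
    have "emeasure (M \<Otimes>\<^sub>M lborel) N \<le> ennreal (1 / c) * (\<integral>\<^sup>+z. G n z * indicator (space (M \<Otimes>\<^sub>M lborel)) z \<partial>(M \<Otimes>\<^sub>M lborel))"
      unfolding N_def by (rule nn_integral_Markov_inequality[OF _ sets.top]) measurable
    also have "\<dots> \<le> ennreal (1 / c) * ennreal (c * e)"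
      using n by (intro mult_left_mono) (auto simp: mult_indicator_cong cong: nn_integral_cong)
    also have "\<dots> = ennreal e" using assms by (simp flip: ennreal_mult)
    finally show "emeasure (M \<Otimes>\<^sub>M lborel) N \<le> ennreal e" .
    show "AE z in M \<Otimes>\<^sub>M lborel. ennreal c \<le> gap n (fst z) (snd z) \<longrightarrow> z \<in> N"
      using G AE_space
    proof eventually_elim
      case (elim z)
      show ?case
      proof
        assume "ennreal c \<le> gap n (fst z) (snd z)"
        then have "ennreal (1 / c) * ennreal c \<le> ennreal (1 / c) * G n z"
          using elim by (intro mult_left_mono) auto
        then show "z \<in> N" using elim assms by (simp add: N_def flip: ennreal_mult)
      qed
    qed
  qed
qed

text \<open>The pathwise counterpart of \<open>gap_exceeds_small\<close>: for almost every \<open>\<omega>\<close> the dominating function is integrable in \<open>x\<close>.\<close>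

lemma gap_integral_tendsto_0: "AE \<omega> in M. (\<lambda>n. \<integral>\<^sup>+x. gap n \<omega> x \<partial>lborel) \<longlonglongrightarrow> 0"
proof -
  obtain G B where "\<forall>n. G n \<in> borel_measurable (M \<Otimes>\<^sub>M lborel)"
    and [measurable]: "B \<in> borel_measurable (M \<Otimes>\<^sub>M lborel)"
    and intB: "(\<integral>\<^sup>+z. B z \<partial>(M \<Otimes>\<^sub>M lborel)) < \<infinity>"
    and G: "AE z in M \<Otimes>\<^sub>M lborel. \<forall>n. gap n (fst z) (snd z) = G n z \<and> G n z \<le> B z"
    and lim: "AE z in M \<Otimes>\<^sub>M lborel. (\<lambda>n. G n z) \<longlonglongrightarrow> 0"
    by (rule gap_dominated) (rule that; assumption)
  then have [measurable]: "G n \<in> borel_measurable (M \<Otimes>\<^sub>M lborel)" for n by blast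
  have "AE \<omega> in M. (\<integral>\<^sup>+x. B (\<omega>, x) \<partial>lborel) \<noteq> \<infinity>"
    using intB by (intro nn_integral_PInf_AE) (auto simp: lborel.nn_integral_fst)
  moreover have "AE \<omega> in M. AE x in lborel. \<forall>n. gap n \<omega> x = G n (\<omega>, x) \<and> G n (\<omega>, x) \<le> B (\<omega>, x)"
    using G by (intro AE_iterated(1)) simp
  moreover have "AE \<omega> in M. AE x in lborel. (\<lambda>n. G n (\<omega>, x)) \<longlonglongrightarrow> 0"
    using lim by (intro AE_iterated(1)) simp
  ultimately show ?thesis using AE_space
  proof eventually_elim
    case (elim \<omega>)
    note [measurable] = \<open>\<omega> \<in> space M\<close>
    have "(\<lambda>n. \<integral>\<^sup>+x. G n (\<omega>, x) \<partial>lborel) \<longlonglongrightarrow> (\<integral>\<^sup>+(x :: real ^ 'd). 0 \<partial>lborel)"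
      by (rule nn_integral_dominated_convergence[where w="\<lambda>x. B (\<omega>, x)"])
        (use elim in \<open>auto elim!: eventually_mono simp: top.not_eq_extremum\<close>)
    moreover have "(\<integral>\<^sup>+x. gap n \<omega> x \<partial>lborel) = (\<integral>\<^sup>+x. G n (\<omega>, x) \<partial>lborel)" for n
      by (rule nn_integral_cong_AE) (use elim(2) in \<open>auto elim!: eventually_mono\<close>)
    ultimately show ?case by simp
  qed
qed

section \<open>Continuity in mean square\<close>

lemma v_in_S2_L2: "in_S2_L2 M W T (v n)"
  using potentials[of n] by (simp add: regular_potential_def)

lemma v_sections:
  "AE \<omega> in M. \<forall>n. \<forall>t\<in>{0..T}. v n \<omega> t \<in> borel_measurable borel \<and>
     ((\<lambda>r. l2_norm_square (\<lambda>x. ereal (real_of_ereal (v n \<omega> r x) - real_of_ereal (v n \<omega> t x))))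
           \<longlongrightarrow> 0) (at t within {0..T})"
  unfolding AE_all_countable
proof
  fix n
  show "AE \<omega> in M. \<forall>t\<in>{0..T}. v n \<omega> t \<in> borel_measurable borel \<and>
     ((\<lambda>r. l2_norm_square (\<lambda>x. ereal (real_of_ereal (v n \<omega> r x) - real_of_ereal (v n \<omega> t x))))
           \<longlongrightarrow> 0) (at t within {0..T})"
    using v_in_S2_L2[of n] unfolding in_S2_L2_def by (auto elim: eventually_mono)
qed

lemma u_sections_measurable: "AE \<omega> in M. \<forall>t\<in>{0..T}. u \<omega> t \<in> borel_measurable borel"
  using v_mono_le_u v_sections
proof eventually_elim
  case (elim \<omega>)
  show ?case
  proof
    fix t assume t: "t \<in> {0..T}"
    then have "u \<omega> t = (\<lambda>x. SUP n. v n \<omega> t x)" using elim(1) by (intro ext) blast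
    moreover have "(\<lambda>x. SUP n. v n \<omega> t x) \<in> borel_measurable borel"
      using elim(2) t by (intro borel_measurable_SUP) auto
    ultimately show "u \<omega> t \<in> borel_measurable borel" by simp
  qed
qed

lemma u_sections_L2: "AE \<omega> in M. \<forall>t\<in>{0..T}. l2_norm_square (u \<omega> t) < \<infinity>"
proof -
  obtain B where [measurable]: "B \<in> borel_measurable (M \<Otimes>\<^sub>M lborel)"
    and intB: "(\<integral>\<^sup>+z. B z \<partial>(M \<Otimes>\<^sub>M lborel)) < \<infinity>"
    and B: "AE z in M \<Otimes>\<^sub>M lborel. B z < \<infinity> \<and> (\<forall>t\<in>{0..T}.
      abs_square (u (fst z) t (snd z + X t (fst z))) \<le> B z \<and>
      abs_square (v 0 (fst z) t (snd z + X t (fst z))) \<le> B z)"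
    by (rule path_domination) (rule that; assumption)
  have "AE z in M \<Otimes>\<^sub>M lborel. \<forall>t\<in>{0..T}. abs_square (u (fst z) t (snd z + X t (fst z))) \<le> B (fst z, snd z)"
    using B by eventually_elim simp
  then have "AE \<omega> in M. AE x in lborel. \<forall>t\<in>{0..T}. abs_square (u \<omega> t (x + X t \<omega>)) \<le> B (\<omega>, x)"
    by (rule AE_iterated(1))
  moreover have "AE \<omega> in M. (\<integral>\<^sup>+x. B (\<omega>, x) \<partial>lborel) \<noteq> \<infinity>"
    using intB by (intro nn_integral_PInf_AE) (auto simp: lborel.nn_integral_fst)
  ultimately show ?thesis using u_sections_measurable
  proof eventually_elim
    case (elim \<omega>)
    show ?case
    proof
      fix t assume t: "t \<in> {0..T}"
      have "l2_norm_square (u \<omega> t) = (\<integral>\<^sup>+x. abs_square (u \<omega> t (x + X t \<omega>)) \<partial>lborel)"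
        using elim(3) t by (intro l2_norm_square_translate) blast
      also have "\<dots> \<le> (\<integral>\<^sup>+x. B (\<omega>, x) \<partial>lborel)"
        by (rule nn_integral_mono_AE, rule eventually_mono[OF elim(1)]) (use t in blast)
      also have "\<dots> < \<infinity>" using elim(2) by (simp add: top.not_eq_extremum)
      finally show "l2_norm_square (u \<omega> t) < \<infinity>" .
    qed
  qed
qed

lemma u_paths_square_integrable:
  "(\<integral>\<^sup>+\<omega>. (\<integral>\<^sup>+x. (SUP t\<in>{0..T}. abs_square (u \<omega> t (x + X t \<omega>))) \<partial>lborel) \<partial>M) < \<infinity>"
  by (rule path_domination)

text \<open>The translation by \<open>X\<^sub>t\<close> does not change the norm, and it turns the values at time \<open>t\<close> into values along paths.\<close>

lemma l2_distance_le_gap: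
  "AE \<omega> in M. \<forall>n. \<forall>t\<in>{0..T}.
     l2_norm_square (\<lambda>x. ereal (real_of_ereal (u \<omega> t x) - real_of_ereal (v n \<omega> t x)))
       \<le> (\<integral>\<^sup>+x. gap n \<omega> x \<partial>lborel)"
  using u_sections_measurable v_sections
proof eventually_elim
  case (elim \<omega>)
  show ?case
  proof (intro allI ballI)
    fix n t assume t: "t \<in> {0..T}"
    have [measurable]: "u \<omega> t \<in> borel_measurable borel" "v n \<omega> t \<in> borel_measurable borel"
      using elim t by blast+
    have "l2_norm_square (\<lambda>x. ereal (real_of_ereal (u \<omega> t x) - real_of_ereal (v n \<omega> t x))) =
      (\<integral>\<^sup>+x. abs_square (ereal (real_of_ereal (u \<omega> t (x + X t \<omega>)) - real_of_ereal (v n \<omega> t (x + X t \<omega>)))) \<partial>lborel)"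
      by (rule l2_norm_square_translate) measurable
    also have "\<dots> \<le> (\<integral>\<^sup>+x. gap n \<omega> x \<partial>lborel)"
      unfolding gap_def abs_square_ereal using t by (intro nn_integral_mono SUP_upper)
    finally show "l2_norm_square (\<lambda>x. ereal (real_of_ereal (u \<omega> t x) - real_of_ereal (v n \<omega> t x)))
       \<le> (\<integral>\<^sup>+x. gap n \<omega> x \<partial>lborel)" .
  qed
qed

text \<open>The potentials are continuous in \<open>L\<^sup>2\<close> and converge to \<open>u\<close> uniformly in time.\<close>

lemma u_in_S2_L2: "in_S2_L2 M W T u"
  unfolding in_S2_L2_def
proof (intro conjI)
  show "AE \<omega> in M. \<forall>t\<in>{0..T}. u \<omega> t \<in> borel_measurable borel \<and> l2_norm_square (u \<omega> t) < \<infinity> \<and>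
        ((\<lambda>r. l2_norm_square (\<lambda>x. ereal (real_of_ereal (u \<omega> r x) - real_of_ereal (u \<omega> t x))))
           \<longlongrightarrow> 0) (at t within {0..T})"
    using u_sections_measurable u_sections_L2 v_sections l2_distance_le_gap gap_integral_tendsto_0
  proof eventually_elim
    case (elim \<omega>)
    show ?case
    proof (intro ballI conjI)
      fix t assume t: "t \<in> {0..T}"
      show "u \<omega> t \<in> borel_measurable borel" using elim(1) t by blast
      show "l2_norm_square (u \<omega> t) < \<infinity>" using elim(2) t by blast
      show "((\<lambda>r. l2_norm_square (\<lambda>x. ereal (real_of_ereal (u \<omega> r x) - real_of_ereal (u \<omega> t x))))
           \<longlongrightarrow> 0) (at t within {0..T})"
      proof (rule tendsto_0_of_approximation[OF _ elim(5)])
        fix n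
        show "((\<lambda>r. l2_norm_square (\<lambda>x. ereal (real_of_ereal (v n \<omega> r x) - real_of_ereal (v n \<omega> t x))))
           \<longlongrightarrow> 0) (at t within {0..T})"
          using elim(3) t by blast
        have "l2_norm_square (\<lambda>x. ereal (real_of_ereal (u \<omega> r x) - real_of_ereal (u \<omega> t x)))
            \<le> 6 * ((\<integral>\<^sup>+x. gap n \<omega> x \<partial>lborel) +
                l2_norm_square (\<lambda>x. ereal (real_of_ereal (v n \<omega> r x) - real_of_ereal (v n \<omega> t x))))"
          if r: "r \<in> {0..T}" for r
          by (rule l2_diff_triangle) (use elim(1,3,4) t r in blast)+
        then show "\<forall>\<^sub>F r in at t within {0..T}.
            l2_norm_square (\<lambda>x. ereal (real_of_ereal (u \<omega> r x) - real_of_ereal (u \<omega> t x)))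
            \<le> 6 * ((\<integral>\<^sup>+x. gap n \<omega> x \<partial>lborel) +
                l2_norm_square (\<lambda>x. ereal (real_of_ereal (v n \<omega> r x) - real_of_ereal (v n \<omega> t x))))"
          by (auto simp: eventually_at_filter)
      qed
    qed
  qed
  have "(\<integral>\<^sup>+\<omega>. (SUP t\<in>{0..T}. l2_norm_square (u \<omega> t)) \<partial>M) \<le>
      (\<integral>\<^sup>+\<omega>. (\<integral>\<^sup>+x. (SUP t\<in>{0..T}. abs_square (u \<omega> t (x + X t \<omega>))) \<partial>lborel) \<partial>M)"
  proof (rule nn_integral_mono_AE)
    show "AE \<omega> in M. (SUP t\<in>{0..T}. l2_norm_square (u \<omega> t)) \<le>
        (\<integral>\<^sup>+x. (SUP t\<in>{0..T}. abs_square (u \<omega> t (x + X t \<omega>))) \<partial>lborel)"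
      using u_sections_measurable
    proof eventually_elim
      case (elim \<omega>)
      show ?case
      proof (rule SUP_least)
        fix t assume t: "t \<in> {0..T}"
        have "l2_norm_square (u \<omega> t) = (\<integral>\<^sup>+x. abs_square (u \<omega> t (x + X t \<omega>)) \<partial>lborel)"
          using elim t by (intro l2_norm_square_translate) blast
        also have "\<dots> \<le> (\<integral>\<^sup>+x. (SUP t\<in>{0..T}. abs_square (u \<omega> t (x + X t \<omega>))) \<partial>lborel)"
          using t by (intro nn_integral_mono SUP_upper)
        finally show "l2_norm_square (u \<omega> t) \<le>
            (\<integral>\<^sup>+x. (SUP t\<in>{0..T}. abs_square (u \<omega> t (x + X t \<omega>))) \<partial>lborel)" .
      qed
    qed
  qed
  then show "(\<integral>\<^sup>+\<omega>. (SUP t\<in>{0..T}. l2_norm_square (u \<omega> t)) \<partial>M) < \<infinity>"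
    using u_paths_square_integrable by (rule order.strict_trans1)
qed (rule u_predictable)

lemma u_terminal_value: "AE \<omega> in M. ((\<lambda>t. l2_norm_square (u \<omega> t)) \<longlongrightarrow> 0) (at_left T)"
proof -
  have "AE \<omega> in M. \<forall>n. ((\<lambda>t. l2_norm_square (v n \<omega> t)) \<longlongrightarrow> 0) (at_left T)"
    unfolding AE_all_countable
  proof
    show "AE \<omega> in M. ((\<lambda>t. l2_norm_square (v n \<omega> t)) \<longlongrightarrow> 0) (at_left T)" for n
      using potentials[of n] by (simp add: regular_potential_def)
  qed
  then show ?thesis
    using u_sections_measurable u_sections_L2 v_sections l2_distance_le_gap gap_integral_tendsto_0
  proof eventually_elim
    case (elim \<omega>)
    note sections = elim(2-5)
    show ?case
    proof (rule tendsto_0_of_approximation[OF _ elim(6)])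
      fix n
      show "((\<lambda>t. l2_norm_square (v n \<omega> t)) \<longlongrightarrow> 0) (at_left T)" using elim(1) by blast
      show "\<forall>\<^sub>F t in at_left T. l2_norm_square (u \<omega> t)
          \<le> 6 * ((\<integral>\<^sup>+x. gap n \<omega> x \<partial>lborel) + l2_norm_square (v n \<omega> t))"
        using eventually_at_left_real[OF T_pos]
      proof eventually_elim
        case (elim t)
        then have "t \<in> {0..T}" by simp
        then show ?case
          by (intro l2_norm_square_le_diff) (use sections in blast)+
      qed
    qed
  qed
qed

section \<open>The inequality for the shift semigroup\<close>

text \<open>When \<open>t + s\<close> exceeds \<open>T\<close>, the left side is 0 for every random function, and the inequality for \<open>v 0\<close> carries over to
\<open>u \<ge> v 0\<close>. Otherwise \<open>P_sigma M W T X s (v n) \<le> v n \<le> u\<close> bounds the conditional expectations of an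
\<open>L\<^sup>1\<close>-convergent sequence.\<close>

lemma u_P_sigma_le:
  assumes t: "t \<in> {0..T}" and s: "0 < s"
  shows "AE x in lborel. AE \<omega> in M. ereal (P_sigma M W T X s u \<omega> t x) \<le> u \<omega> t x"
proof -
  have v: "AE x in lborel. AE \<omega> in M. ereal (P_sigma M W T X s (v n) \<omega> t x) \<le> v n \<omega> t x" for n
    using potentials[of n] t s by (simp add: regular_potential_def)
  have v_le_u: "AE \<omega> in M. \<forall>x n. v n \<omega> t x \<le> u \<omega> t x"
    using v_mono_le_u by eventually_elim (use t in blast)
  show ?thesis
  proof (cases "t + s \<le> T")
    case False
    show ?thesis
      using v[of 0]
    proof eventually_elim
      case (elim x)
      with v_le_u show ?case
      proof eventually_elim
        case (elim \<omega>)
        have "ereal (P_sigma M W T X s u \<omega> t x) = ereal (P_sigma M W T X s (v 0) \<omega> t x)"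
          using False by (simp add: P_sigma_def)
        also have "\<dots> \<le> v 0 \<omega> t x" using elim by blast
        also have "\<dots> \<le> u \<omega> t x" using elim by blast
        finally show ?case .
      qed
    qed
  next
    case True
    define r where "r = t + s"
    have r: "r \<in> {0..T}" using True t s by (simp add: r_def)
    interpret F: finite_measure_subalgebra M "augmented_filtration M W t"
      by unfold_locales (rule subalgebra_filtration)
    have P: "P_sigma M W T X s w \<omega> t x = real_cond_exp M (augmented_filtration M W t)
        (\<lambda>\<omega>. real_of_ereal (w \<omega> r (x + X r \<omega> - X t \<omega>))) \<omega>" for w \<omega> x
      using True by (simp add: P_sigma_def r_def)
    have "AE x in lborel. \<forall>n. (AE \<omega> in M. ereal (P_sigma M W T X s (v n) \<omega> t x) \<le> v n \<omega> t x)"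
      unfolding AE_all_countable using v by blast
    moreover have "AE x in lborel. \<forall>n. integrable M (\<lambda>\<omega>. real_of_ereal (v n \<omega> r (x + X r \<omega> - X t \<omega>))) \<and>
        (AE \<omega> in M. \<bar>v n \<omega> r (x + X r \<omega> - X t \<omega>)\<bar> \<noteq> \<infinity>)"
      unfolding AE_all_countable using shifted_value_integrable[OF v_in_S2_L2 t r] by blast
    ultimately show ?thesis using shifted_value_integrable[OF u_in_S2_L2 t r]
    proof eventually_elim
      case (elim x)
      define f where "f \<omega> = real_of_ereal (u \<omega> r (x + X r \<omega> - X t \<omega>))" for \<omega>
      define fn where "fn n \<omega> = real_of_ereal (v n \<omega> r (x + X r \<omega> - X t \<omega>))" for n \<omega>
      have int [measurable]: "integrable M f" "integrable M (fn n)" for n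
        using elim unfolding f_def fn_def by blast+
      have "AE \<omega> in M. \<forall>n. \<bar>v n \<omega> r (x + X r \<omega> - X t \<omega>)\<bar> \<noteq> \<infinity>"
        unfolding AE_all_countable using elim(2) by blast
      moreover have "AE \<omega> in M. \<bar>u \<omega> r (x + X r \<omega> - X t \<omega>)\<bar> \<noteq> \<infinity>" using elim(3) by blast
      ultimately have conv: "AE \<omega> in M. (\<forall>n. fn n \<omega> \<le> f \<omega> \<and> fn 0 \<omega> \<le> fn n \<omega>) \<and> (\<lambda>n. fn n \<omega>) \<longlonglongrightarrow> f \<omega>"
        using v_mono_le_u
      proof eventually_elim
        case (elim \<omega>)
        define y where "y = x + X r \<omega> - X t \<omega>"
        have real: "v n \<omega> r y = ereal (fn n \<omega>)" "u \<omega> r y = ereal (f \<omega>)" for n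
          using elim(1,2) by (simp_all add: f_def fn_def ereal_real' y_def)
        have "(\<forall>m n. m \<le> n \<longrightarrow> v m \<omega> r y \<le> v n \<omega> r y) \<and> (\<forall>n. v n \<omega> r y \<le> u \<omega> r y) \<and>
          (\<lambda>n. v n \<omega> r y) \<longlonglongrightarrow> u \<omega> r y"
          using elim(3) r by blast
        then show ?case by (simp add: real)
      qed
      have "AE \<omega> in M. ereal (real_cond_exp M (augmented_filtration M W t) f \<omega>) \<le> u \<omega> t x"
      proof (rule F.real_cond_exp_le_of_L1_limit[of f fn])
        show "AE \<omega> in M. fn n \<omega> \<le> f \<omega>" for n using conv by eventually_elim blast
        fix n
        have "AE \<omega> in M. ereal (P_sigma M W T X s (v n) \<omega> t x) \<le> v n \<omega> t x"
          using elim(1) by blast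
        then show "AE \<omega> in M. ereal (real_cond_exp M (augmented_filtration M W t) (fn n) \<omega>) \<le> u \<omega> t x"
          using v_le_u unfolding P fn_def[symmetric]
        proof eventually_elim
          case (elim \<omega>)
          from elim(1) show ?case by (rule order_trans) (use elim(2) in blast)
        qed
      next
        have "(\<lambda>n. \<integral>\<^sup>+\<omega>. ennreal (f \<omega> - fn n \<omega>) \<partial>M) \<longlonglongrightarrow> (\<integral>\<^sup>+\<omega>. 0 \<partial>M)"
        proof (rule nn_integral_dominated_convergence[where w="\<lambda>\<omega>. ennreal (f \<omega> - fn 0 \<omega>)"])
          show "AE \<omega> in M. ennreal (f \<omega> - fn n \<omega>) \<le> ennreal (f \<omega> - fn 0 \<omega>)" for n
            using conv by eventually_elim (auto intro: ennreal_leI)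
          have "(\<integral>\<^sup>+\<omega>. ennreal (f \<omega> - fn 0 \<omega>) \<partial>M) = ennreal (\<integral>\<omega>. f \<omega> - fn 0 \<omega> \<partial>M)"
            using int conv by (intro nn_integral_eq_integral) (auto elim: eventually_mono)
          then show "(\<integral>\<^sup>+\<omega>. ennreal (f \<omega> - fn 0 \<omega>) \<partial>M) < \<infinity>" by simp
          show "AE \<omega> in M. (\<lambda>n. ennreal (f \<omega> - fn n \<omega>)) \<longlonglongrightarrow> 0"
            using conv
          proof eventually_elim
            case (elim \<omega>)
            then have "(\<lambda>n. ennreal (f \<omega> - fn n \<omega>)) \<longlonglongrightarrow> ennreal (f \<omega> - f \<omega>)"
              by (intro tendsto_ennrealI tendsto_intros) blast
            then show ?case by simp
          qed
        qed measurable
        then show "(\<lambda>n. \<integral>\<^sup>+\<omega>. ennreal (f \<omega> - fn n \<omega>) \<partial>M) \<longlonglongrightarrow> 0" by simp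
      qed (use int in blast)+
      then show ?case unfolding P f_def .
    qed
  qed
qed

section \<open>Quasi-continuity of the limit\<close>

text \<open>Half of the tolerance \<open>\<epsilon>\<close> is spent on the exceptional sets \<open>D n\<close> of the potentials, the other half on the sets \<open>F k n\<close>
where \<open>v n\<close> exceeds \<open>v (m k)\<close> by more than \<open>\<delta> k\<close>. If a path hits \<open>F k n\<close> for some \<open>n\<close>, then along this path \<open>u\<close> exceeds
\<open>v (m k)\<close> by more than \<open>\<delta> k\<close>, so that the sets \<open>F k n\<close> for all \<open>n\<close> together cost no more than a large gap.
The potentials are compared with each other rather than with \<open>u\<close> because their continuity off the sets \<open>D n\<close> is what makes
the union open.\<close>

lemma u_quasi_continuous: "quasi_continuous M W T X u"
  unfolding quasi_continuous_def
proof (intro allI impI)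
  fix \<epsilon> :: real assume \<epsilon>: "0 < \<epsilon>"
  let ?PS = "predictable_sigma M W T \<Otimes>\<^sub>M (borel :: (real ^ 'd) measure)"
  let ?\<mu> = "M \<Otimes>\<^sub>M (lborel :: (real ^ 'd) measure)"
  define S where "S = {0..T} \<times> (UNIV :: (real ^ 'd) set)"
  define hits where "hits D = {(\<omega>, x). \<omega> \<in> space M \<and> (\<exists>t\<in>{0..T}. ((\<omega>, t), x + X t \<omega>) \<in> D)}"
    for D :: "(('w \<times> real) \<times> (real ^ 'd)) set"
  define sec where "sec D \<omega> = {(t, x). ((\<omega>, t), x) \<in> D}"
    for D :: "(('w \<times> real) \<times> (real ^ 'd)) set" and \<omega>
  define e where "e n = \<epsilon> / 2 * (1 / 2) ^ Suc n" for n
  define \<delta> where "\<delta> k = (1 / 2 :: real) ^ k" for k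
  have e_pos: "0 < e n" for n using \<epsilon> by (simp add: e_def)
  have \<delta>_pos: "0 < \<delta> k" for k by (simp add: \<delta>_def)
  have sum_e: "(\<Sum>n. ennreal (e n)) = ennreal (\<epsilon> / 2)"
    using sums_mult[OF power_half_series, of "\<epsilon> / 2"] e_pos
    by (intro suminf_ennreal_eq) (auto simp: e_def less_imp_le)

  define good where "good n D B \<longleftrightarrow> D \<in> sets ?PS \<and> B \<in> sets ?\<mu> \<and> hits D \<subseteq> B \<and>
      emeasure ?\<mu> B \<le> ennreal (e n) \<and> (AE \<omega> in M. openin (top_of_set S) (sec D \<omega>) \<and>
      continuous_on (S - sec D \<omega>) (\<lambda>(t, x). v n \<omega> t x))" for n D B
  \<comment> \<open>\<open>B n\<close> is a measurable hull of the paths that hit \<open>D n\<close>; the set of these paths need not be measurable\<close>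
  have "\<forall>n. \<exists>D. \<exists>B. good n D B"
  proof
    fix n
    have "quasi_continuous M W T X (v n)" using potentials[of n] by (simp add: regular_potential_def)
    from this[unfolded quasi_continuous_def, rule_format, OF e_pos[of n]]
    obtain D where D: "D \<in> sets ?PS" "outer_measure_of ?\<mu> (hits D) \<le> ennreal (e n)"
      "AE \<omega> in M. openin (top_of_set S) (sec D \<omega>) \<and> continuous_on (S - sec D \<omega>) (\<lambda>(t, x). v n \<omega> t x)"
      by (elim bexE conjE) (rule that; unfold hits_def sec_def S_def, assumption)
    have "hits D \<subseteq> space ?\<mu>" by (auto simp: hits_def space_pair_measure)
    from outer_measure_of_attain[OF this]
    obtain B where "B \<in> sets ?\<mu>" "hits D \<subseteq> B" "outer_measure_of ?\<mu> (hits D) = emeasure ?\<mu> B"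
      by blast
    with D have "good n D B" unfolding good_def by (intro conjI) simp_all
    then show "\<exists>D. \<exists>B. good n D B" by blast
  qed
  then obtain D where "\<forall>n. \<exists>B. good n (D n) B" by (rule choice[THEN exE])
  then obtain B where "\<forall>n. good n (D n) (B n)" by (rule choice[THEN exE])
  then have D_sets: "D n \<in> sets ?PS" and B_sets: "B n \<in> sets ?\<mu>" and hits_D: "hits (D n) \<subseteq> B n"
    and B_le: "emeasure ?\<mu> (B n) \<le> ennreal (e n)"
    and D_AE: "AE \<omega> in M. openin (top_of_set S) (sec (D n) \<omega>) \<and>
      continuous_on (S - sec (D n) \<omega>) (\<lambda>(t, x). v n \<omega> t x)" for n
    unfolding good_def by blast+

  define small where "small k m N \<longleftrightarrow> N \<in> sets ?\<mu> \<and> emeasure ?\<mu> N \<le> ennreal (e k) \<and>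
      (AE z in ?\<mu>. ennreal ((\<delta> k)\<^sup>2) \<le> gap m (fst z) (snd z) \<longrightarrow> z \<in> N)" for k m N
  have "\<forall>k. \<exists>m. \<exists>N. small k m N"
  proof
    fix k
    have "0 < (\<delta> k)\<^sup>2" using \<delta>_pos[of k] by simp
    then obtain m N where "small k m N"
      by (rule gap_exceeds_small[OF _ e_pos[of k]]) (rule that, unfold small_def, intro conjI)
    then show "\<exists>m. \<exists>N. small k m N" by blast
  qed
  then obtain m where "\<forall>k. \<exists>N. small k (m k) N" by (rule choice[THEN exE])
  then obtain N where "\<forall>k. small k (m k) (N k)" by (rule choice[THEN exE])
  then have N_sets: "N k \<in> sets ?\<mu>" and N_le: "emeasure ?\<mu> (N k) \<le> ennreal (e k)"
    and N_AE: "AE z in ?\<mu>. ennreal ((\<delta> k)\<^sup>2) \<le> gap (m k) (fst z) (snd z) \<longrightarrow> z \<in> N k" for k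
    by (simp_all add: small_def)

  define version where "version n p \<longleftrightarrow> (\<lambda>((\<omega>, t), x). p \<omega> t x) \<in> borel_measurable ?PS \<and>
      (AE \<omega> in M. \<forall>t\<in>{0..T}. \<forall>x. v n \<omega> t x = p \<omega> t x)" for n p
  have "\<forall>n. \<exists>p. version n p" using v_predictable by (simp add: version_def predictable_version_def)
  then obtain p where "\<forall>n. version n (p n)" by (rule choice[THEN exE])
  then have p_meas: "(\<lambda>((\<omega>, t), x). p n \<omega> t x) \<in> borel_measurable ?PS"
    and p_eq: "AE \<omega> in M. \<forall>t\<in>{0..T}. \<forall>x. v n \<omega> t x = p n \<omega> t x" for n
    by (simp_all add: version_def)
  have p_eq_all: "AE \<omega> in M. \<forall>n. \<forall>t\<in>{0..T}. \<forall>x. v n \<omega> t x = p n \<omega> t x"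
    unfolding AE_all_countable using p_eq by blast

  define q where "q n z = p n (fst (fst z)) (snd (fst z)) (snd z)" for n z
  have q_meas: "q n \<in> borel_measurable ?PS" for n
    using p_meas[of n] by (simp add: q_def[abs_def] case_prod_beta')
  define F where "F k n = {z \<in> space ?PS. \<delta> k < compress (q n z) - compress (q (m k) z)}" for k n
  have F_sets: "F k n \<in> sets ?PS" for k n
    unfolding F_def
    by (intro borel_measurable_less borel_measurable_diff borel_measurable_const
        measurable_compose[OF q_meas borel_measurable_compress])
  define E where "E = (\<Union>n. D n) \<union> (\<Union>k. \<Union>n. F k n)"
  have E_sets: "E \<in> sets ?PS" unfolding E_def using D_sets F_sets by blast
  have sec_F: "sec (F k n) \<omega> = {(t, x) \<in> S. \<delta> k < compress (v n \<omega> t x) - compress (v (m k) \<omega> t x)}"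
    if "\<omega> \<in> space M" "\<forall>n. \<forall>t\<in>{0..T}. \<forall>x. v n \<omega> t x = p n \<omega> t x" for \<omega> k n
    using that by (auto simp: sec_def F_def q_def S_def space_pair_measure)

  have D_AE_all: "AE \<omega> in M. \<forall>n. openin (top_of_set S) (sec (D n) \<omega>) \<and>
      continuous_on (S - sec (D n) \<omega>) (\<lambda>(t, x). v n \<omega> t x)"
    unfolding AE_all_countable using D_AE by blast
  have "AE \<omega> in M. openin (top_of_set S) (sec E \<omega>) \<and> continuous_on (S - sec E \<omega>) (\<lambda>(t, x). u \<omega> t x)"
    using p_eq_all D_AE_all v_mono_le_u AE_space
  proof eventually_elim
    case (elim \<omega>)
    note sec_F = sec_F[OF elim(4,1)] and limit = elim(3)
    have sec_E: "sec E \<omega> = (\<Union>n. sec (D n) \<omega>) \<union> (\<Union>k. \<Union>n. sec (F k n) \<omega>)"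
      by (auto simp: sec_def E_def)
    have cont: "continuous_on (S - A) (\<lambda>z. compress (v n \<omega> (fst z) (snd z)))"
      if "sec (D n) \<omega> \<subseteq> A" for A n
    proof -
      have "continuous_on (S - sec (D n) \<omega>) (\<lambda>z. v n \<omega> (fst z) (snd z))"
        using elim(2) by (simp add: case_prod_beta')
      then show ?thesis
        unfolding continuous_on_compress_comp_iff by (rule continuous_on_subset) (use that in blast)
    qed
    \<comment> \<open>\<open>F k n\<close> alone need not be open; it is once the exceptional sets of both functions are added\<close>
    have "openin (top_of_set S) (sec (D n) \<omega> \<union> sec (D (m k)) \<omega> \<union> sec (F k n) \<omega>)" for k n
    proof -
      have "sec (F k n) \<omega> = {z \<in> S. \<delta> k < compress (v n \<omega> (fst z) (snd z)) - compress (v (m k) \<omega> (fst z) (snd z))}"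
        unfolding sec_F by auto
      moreover have "openin (top_of_set S) (sec (D n) \<omega> \<union> sec (D (m k)) \<omega>)"
        using elim(2) by (intro openin_Un) blast+
      ultimately show ?thesis
        by (simp only:) (intro openin_Un_superlevel continuous_on_diff cont; blast)
    qed
    then have "openin (top_of_set S) (\<Union>k. \<Union>n. sec (D n) \<omega> \<union> sec (D (m k)) \<omega> \<union> sec (F k n) \<omega>)"
      by (intro openin_Union ballI) auto
    also have "(\<Union>k. \<Union>n. sec (D n) \<omega> \<union> sec (D (m k)) \<omega> \<union> sec (F k n) \<omega>) = sec E \<omega>"
      unfolding sec_E by blast
    finally have op: "openin (top_of_set S) (sec E \<omega>)" .
    have lim: "uniform_limit (S - sec E \<omega>) (\<lambda>k z. compress (v (m k) \<omega> (fst z) (snd z)))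
        (\<lambda>z. compress (u \<omega> (fst z) (snd z))) sequentially"
    proof (rule uniform_limitI)
      fix r :: real assume "0 < r"
      have "\<forall>\<^sub>F k in sequentially. \<delta> k < r"
        using \<open>0 < r\<close> unfolding \<delta>_def by (intro order_tendstoD(2)[OF LIMSEQ_realpow_zero]) auto
      then show "\<forall>\<^sub>F k in sequentially. \<forall>z\<in>S - sec E \<omega>.
          dist (compress (v (m k) \<omega> (fst z) (snd z))) (compress (u \<omega> (fst z) (snd z))) < r"
      proof eventually_elim
        case (elim k)
        show ?case
        proof
          fix z assume z: "z \<in> S - sec E \<omega>"
          obtain t x where tx: "z = (t, x)" "t \<in> {0..T}" using z by (auto simp: S_def)
          have v: "(\<forall>n. v n \<omega> t x \<le> u \<omega> t x) \<and> (\<lambda>n. v n \<omega> t x) \<longlonglongrightarrow> u \<omega> t x"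
            using limit tx(2) by blast
          have "(\<lambda>n. compress (v n \<omega> t x)) \<longlonglongrightarrow> compress (u \<omega> t x)"
            by (rule continuous_on_tendsto_compose[OF continuous_on_compress[of UNIV]]) (use v in auto)
          moreover have "compress (v n \<omega> t x) \<le> compress (v (m k) \<omega> t x) + \<delta> k" for n
          proof -
            have "z \<notin> sec (F k n) \<omega>" using z sec_E by blast
            then show ?thesis using z tx unfolding sec_F by auto
          qed
          ultimately have "compress (u \<omega> t x) \<le> compress (v (m k) \<omega> t x) + \<delta> k"
            by (intro LIMSEQ_le_const2) auto
          moreover have "compress (v (m k) \<omega> t x) \<le> compress (u \<omega> t x)" using v by simp
          ultimately show "dist (compress (v (m k) \<omega> (fst z) (snd z))) (compress (u \<omega> (fst z) (snd z))) < r"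
            using elim by (simp add: tx dist_real_def)
        qed
      qed
    qed
    have "continuous_on (S - sec E \<omega>) (\<lambda>z. compress (u \<omega> (fst z) (snd z)))"
      by (rule uniform_limit_theorem[OF always_eventually lim]) (use sec_E in \<open>auto intro!: cont\<close>)
    then have "continuous_on (S - sec E \<omega>) (\<lambda>(t, x). u \<omega> t x)"
      by (simp add: continuous_on_compress_comp_iff case_prod_beta')
    with op show ?case by blast
  qed
  moreover have "outer_measure_of ?\<mu> (hits E) \<le> ennreal \<epsilon>"
  proof -
    have "AE z in ?\<mu>. \<forall>k. ennreal ((\<delta> k)\<^sup>2) \<le> gap (m k) (fst z) (snd z) \<longrightarrow> z \<in> N k"
      unfolding AE_all_countable using N_AE by blast
    then have "AE z in ?\<mu>. \<forall>k n. \<forall>t\<in>{0..T}. ((fst z, t), snd z + X t (fst z)) \<in> F k n \<longrightarrow> z \<in> N k"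
      using paths_finite AE_product_of_AE[OF v_mono_le_u] AE_product_of_AE[OF p_eq_all]
    proof eventually_elim
      case (elim z)
      show ?case
      proof (intro allI ballI impI)
        fix k n t assume t: "t \<in> {0..T}" and F: "((fst z, t), snd z + X t (fst z)) \<in> F k n"
        define U where "U = u (fst z) t (snd z + X t (fst z))"
        define V where "V i = v i (fst z) t (snd z + X t (fst z))" for i
        have "\<delta> k < compress (V n) - compress (V (m k))"
          using F elim(4) t by (simp add: F_def q_def V_def)
        also have "\<dots> \<le> compress U - compress (V (m k))"
        proof -
          have "V n \<le> U" unfolding U_def V_def using elim(3) t by blast
          then show ?thesis by simp
        qed
        also have "\<dots> \<le> \<bar>real_of_ereal U - real_of_ereal (V (m k))\<bar>"
        proof -
          have "\<bar>U\<bar> \<noteq> \<infinity>" "\<bar>V (m k)\<bar> \<noteq> \<infinity>" unfolding U_def V_def using elim(2) t by auto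
          from compress_diff_le[OF this] show ?thesis by simp
        qed
        finally have "(\<delta> k)\<^sup>2 \<le> \<bar>real_of_ereal U - real_of_ereal (V (m k))\<bar>\<^sup>2"
          using \<delta>_pos[of k] by (intro power_mono) auto
        then have "ennreal ((\<delta> k)\<^sup>2) \<le> ennreal ((real_of_ereal U - real_of_ereal (V (m k)))\<^sup>2)"
          by (simp add: ennreal_leI)
        also have "\<dots> \<le> gap (m k) (fst z) (snd z)"
          unfolding gap_def U_def V_def using t by (rule SUP_upper)
        finally show "z \<in> N k" using elim(1) by blast
      qed
    qed
    then obtain Z where Z: "{z \<in> space ?\<mu>. \<not> (\<forall>k n. \<forall>t\<in>{0..T}.
        ((fst z, t), snd z + X t (fst z)) \<in> F k n \<longrightarrow> z \<in> N k)} \<subseteq> Z" "emeasure ?\<mu> Z = 0" "Z \<in> sets ?\<mu>"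
      by (rule AE_E)
    have "hits E \<subseteq> (\<Union>n. B n) \<union> (\<Union>k. N k) \<union> Z"
    proof
      fix z assume "z \<in> hits E"
      then obtain t where z: "fst z \<in> space M" "t \<in> {0..T}" and E: "((fst z, t), snd z + X t (fst z)) \<in> E"
        by (auto simp: hits_def)
      from E consider n where "((fst z, t), snd z + X t (fst z)) \<in> D n" |
          k n where "((fst z, t), snd z + X t (fst z)) \<in> F k n"
        by (auto simp: E_def)
      then show "z \<in> (\<Union>n. B n) \<union> (\<Union>k. N k) \<union> Z"
      proof cases
        case 1
        then have "z \<in> hits (D n)" using z by (auto simp: hits_def case_prod_beta)
        then show ?thesis using hits_D by blast
      next
        case 2
        moreover have "z \<in> space ?\<mu>" using z(1) by (cases z) (simp add: space_pair_measure)
        ultimately show ?thesis using Z(1) z(2) by blast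
      qed
    qed
    then have "outer_measure_of ?\<mu> (hits E) \<le> outer_measure_of ?\<mu> ((\<Union>n. B n) \<union> (\<Union>k. N k) \<union> Z)"
      by (rule outer_measure_of_mono)
    also have "\<dots> = emeasure ?\<mu> ((\<Union>n. B n) \<union> (\<Union>k. N k) \<union> Z)"
      using B_sets N_sets Z(3) by (intro outer_measure_of_eq) auto
    also have "\<dots> \<le> emeasure ?\<mu> ((\<Union>n. B n) \<union> (\<Union>k. N k)) + emeasure ?\<mu> Z"
      using B_sets N_sets Z(3) by (intro emeasure_subadditive) auto
    also have "\<dots> \<le> emeasure ?\<mu> (\<Union>n. B n) + emeasure ?\<mu> (\<Union>k. N k)"
      unfolding Z(2) add_0_right using B_sets N_sets by (intro emeasure_subadditive) auto
    also have "\<dots> \<le> (\<Sum>n. emeasure ?\<mu> (B n)) + (\<Sum>k. emeasure ?\<mu> (N k))"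
      using B_sets N_sets by (intro add_mono emeasure_subadditive_countably) auto
    also have "\<dots> \<le> (\<Sum>n. ennreal (e n)) + (\<Sum>n. ennreal (e n))"
      using B_le N_le by (intro add_mono suminf_le) auto
    also have "\<dots> = ennreal \<epsilon>"
      unfolding sum_e using \<epsilon> by (simp flip: ennreal_plus)
    finally show ?thesis .
  qed
  ultimately show "\<exists>D \<in> sets ?PS. (AE \<omega> in M.
           openin (top_of_set ({0..T} \<times> UNIV)) {(t, x). ((\<omega>, t), x) \<in> D} \<and>
           continuous_on ({0..T} \<times> UNIV - {(t, x). ((\<omega>, t), x) \<in> D}) (\<lambda>(t, x). u \<omega> t x)) \<and>
        outer_measure_of ?\<mu>
          {(\<omega>, x). \<omega> \<in> space M \<and> (\<exists>t\<in>{0..T}. ((\<omega>, t), x + X t \<omega>) \<in> D)} \<le> ennreal \<epsilon>"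
    using E_sets unfolding hits_def sec_def S_def by blast
qed

lemma u_regular_potential: "regular_potential M W T X u"
  unfolding regular_potential_def
  using u_in_S2_L2 u_quasi_continuous u_terminal_value u_paths_square_integrable u_P_sigma_le by blast

end

section \<open>The limit is a regular potential\<close>

theorem proposition3p8:
  fixes M :: "'w measure"
    and W :: "real \<Rightarrow> 'w \<Rightarrow> real ^ 'm"
    and T :: real
    and U :: "(real ^ 'm ^ 'd) set"
    and \<sigma> :: "real \<Rightarrow> 'w \<Rightarrow> real ^ 'm ^ 'd"
    and X :: "real \<Rightarrow> 'w \<Rightarrow> real ^ 'd"
    and v :: "nat \<Rightarrow> 'w \<Rightarrow> real \<Rightarrow> real ^ 'd \<Rightarrow> ereal"
    and u :: "'w \<Rightarrow> real \<Rightarrow> real ^ 'd \<Rightarrow> ereal"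
  assumes "prob_space M" and "complete_measure M" and "wiener_process M W"
    and "0 < T"
    and "U \<noteq> {}" and "bounded U"
    and "\<sigma> \<in> controls M W T U"
    and "is_ito_integral M W T \<sigma> X"
    and "\<And>n. 1 \<le> n \<Longrightarrow> regular_potential M W T X (v n)"
    and "AE \<omega> in M. \<forall>t\<in>{0..T}. \<forall>x.
           (\<forall>n\<ge>1. v n \<omega> t x \<le> v (Suc n) \<omega> t x) \<and> (\<lambda>n. v n \<omega> t x) \<longlonglongrightarrow> u \<omega> t x"
    and "AE (\<omega>, x) in M \<Otimes>\<^sub>M lborel. continuous_on {0..T} (\<lambda>t. u \<omega> t (x + X t \<omega>))"
    and "(\<integral>\<^sup>+x. (\<integral>\<^sup>+\<omega>. (SUP t\<in>{0..T}. abs_square (u \<omega> t (x + X t \<omega>))) \<partial>M) \<partial>lborel) < \<infinity>"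
  shows "regular_potential M W T X u"
proof -
  interpret prob_space M by fact
  interpret complete_measure M by fact
  have increasing: "AE \<omega> in M. \<forall>t\<in>{0..T}. \<forall>x.
      (\<forall>n. v (Suc n) \<omega> t x \<le> v (Suc (Suc n)) \<omega> t x) \<and> (\<lambda>n. v (Suc n) \<omega> t x) \<longlonglongrightarrow> u \<omega> t x"
    using assms(10)
  proof eventually_elim
    case (elim \<omega>)
    show ?case
    proof (intro ballI allI conjI)
      fix t x n assume t: "t \<in> {0..T}"
      show "v (Suc n) \<omega> t x \<le> v (Suc (Suc n)) \<omega> t x" using elim t by simp
      show "(\<lambda>n. v (Suc n) \<omega> t x) \<longlonglongrightarrow> u \<omega> t x"
        by (rule LIMSEQ_Suc) (use elim t in blast)
    qed
  qed
  interpret increasing_potentials M W T X "\<lambda>n. v (Suc n)" u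
  proof
    show "W s \<in> borel_measurable M" if "0 \<le> s" for s
      using assms(3) that by (simp add: wiener_process_def)
    show "X t \<in> borel_measurable (augmented_filtration M W t)" if "t \<in> {0..T}" for t
      using assms(8) that unfolding is_ito_integral_def by blast
    show "AE \<omega> in M. continuous_on {0..T} (\<lambda>t. X t \<omega>)"
      using assms(8) unfolding is_ito_integral_def by blast
    show "regular_potential M W T X (v (Suc n))" for n using assms(9) by simp
    show "AE z in M \<Otimes>\<^sub>M lborel. continuous_on {0..T} (\<lambda>t. u (fst z) t (snd z + X t (fst z)))"
      using assms(11) by (simp add: case_prod_beta')
  qed (fact assms(4) increasing assms(12))+
  show ?thesis by (rule u_regular_potential)
qed

end
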